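(* Let $\mathcal S=(a_i)_{i\ge1}$ be an infinite sequence of elementary foldings that is periodic with even period $k$, i.e. $k$ is even and $a_{i+k}=a_i$ for all $i\ge1$, and let $G=F_{a_1}\circ F_{a_2}\circ\dots\circ F_{a_k}$. Let the seed $\sigma$ be the positive unit triangle $T_0$ with all three sides red if $a_1=+$, and with all three sides blue if $a_1=-$. Then the pattern $P_{\mathcal S}$ is generated by the substitution $G$ with seed $\sigma$: for every $n\ge1$, $G^n(\sigma)$ is an edge coloring of the positive triangle $2^{kn}T_0$ centered at $O$ that coincides with $P_{\mathcal S}$ on all unit edges in the interior of $2^{kn}T_0$.
   Context: Grid: let $\xi_1=(0,-2\sqrt3)$ and let $\xi_2,\xi_3$ be its counterclockwise rotations by $2\pi/3$ and $4\pi/3$. For $i\in\{1,2,3\}$, $n\in\mathbb Z$ put $\ell_{i,n}=\{x\in\mathbb R^2:(x,\xi_i)=3n+1\}$. The union $\mathcal L$ of all $\ell_{i,n}$ is a triangular grid whose smallest triangles (unit triangles) are regular of side $1$; unit edges are the sides of unit triangles. A regular triangle is positive if its vertex opposite its horizontal side lies above that side, negative otherwise. $O$ is the origin and $T_0$ is the positive unit triangle centered at $O$; $\lambda T_0$ denotes the image of $T_0$ under the homothety with center $O$ and ratio $\lambda$. Folding patterns: an elementary folding folds a paper regular triangle of side $2a$ along its three midsegments onto its central triangle of side $a$; it is a folding up ($+$) if all three folds go through the upper half-space of $\mathbb R^3$ and a folding down ($-$) if all go through the lower half-space. When unfolded, fold lines of a folding up become valleys and those of a folding down become peaks. For a finite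 sequence $(a_1,\dots,a_m)$ take the paper triangle $(-2)^mT_0$, perform $a_m$ first (onto $(-2)^{m-1}T_0$), then $a_{m-1}$, …, finally $a_1$ (onto $T_0$), then unfold; valleys are colored red and peaks blue. For an infinite sequence $\mathcal S=(a_i)_{i\ge1}$, $P_{\mathcal S}$ is the red/blue coloring of all unit edges of $\mathcal L$ in which each edge gets its color from the pattern of $(a_1,\dots,a_m)$ for any $m$ with the edge interior to $(-2)^mT_0$. Substitutions: an edge-colored triangle is a regular triangle $\Delta$ of integer side $m$, subdivided into $m^2$ unit triangles by lines parallel to its sides, with each unit edge colored red or blue. For $\epsilon\in\{+,-\}$, the substitution $F_\epsilon$ maps it to the edge-colored triangle $2\Delta$ (homothety of ratio $2$ centered at the center of $\Delta$; same orientation), where each unit triangle $\tau$ of $\Delta$ becomes $2\tau$, subdivided into four unit triangles (three corner ones and one central one of opposite orientation), colored as follows: each unit edge $e$ of $\Delta$ becomes a segment of length $2$ whose two unit edges both get the color opposite to that of $e$; the three interior unit edges of $2\tau$ are colored, for $F_+$, blue if $\tau$ is positive and red if $\tau$ is negative, and, for $F_-$, red if $\tau$ is positive and blue if $\tau$ is negative. *)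

theory Defs
  imports "HOL-Analysis.Analysis"
begin

text \<open>The Euclidean plane is the type \<^typ>\<open>complex\<close>, whose inner product is the standard one;
  counterclockwise rotation by \<open>t\<close> is multiplication by \<open>cis t\<close>.\<close>

definition xi :: "nat \<Rightarrow> complex" where
  "xi i = cis (2 * pi * (real i - 1) / 3) * Complex 0 (- 2 * sqrt 3)"

definition grid_line :: "nat \<Rightarrow> int \<Rightarrow> complex set" where
  "grid_line i n = {x. x \<bullet> xi i = 3 * real_of_int n + 1}"

definition grid_nodes :: "complex set" where
  "grid_nodes = {x. \<exists>i\<in>{1,2,3}. \<exists>j\<in>{1,2,3}. i \<noteq> j \<and> (\<exists>n. x \<in> grid_line i n) \<and> (\<exists>n. x \<in> grid_line j n)}"

text \<open>Regular triangles are closed regions of the plane.\<close>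

definition regular_corners :: "real \<Rightarrow> complex \<Rightarrow> complex \<Rightarrow> complex \<Rightarrow> bool" where
  "regular_corners s p q r \<longleftrightarrow> s > 0 \<and> dist p q = s \<and> dist q r = s \<and> dist r p = s"

definition regular_triangle :: "real \<Rightarrow> complex set \<Rightarrow> bool" where
  "regular_triangle s D \<longleftrightarrow> (\<exists>p q r. regular_corners s p q r \<and> D = convex hull {p, q, r})"

definition positive_triangle :: "complex set \<Rightarrow> bool" where
  "positive_triangle D \<longleftrightarrow> (\<exists>s p q r. regular_corners s p q r \<and> D = convex hull {p, q, r}
      \<and> Im p = Im q \<and> Im r > Im p)"

definition negative_triangle :: "complex set \<Rightarrow> bool" where
  "negative_triangle D \<longleftrightarrow> (\<exists>s p q r. regular_corners s p q r \<and> D = convex hull {p, q, r}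
      \<and> Im p = Im q \<and> Im r < Im p)"

definition center :: "complex set \<Rightarrow> complex" where
  "center D = (\<Sum>v | v extreme_point_of D. v) / 3"

definition homothety :: "complex \<Rightarrow> real \<Rightarrow> complex \<Rightarrow> complex" where
  "homothety z t x = z + t *\<^sub>R (x - z)"

definition T0 :: "complex set" where
  "T0 = convex hull {Complex (- 1 / 2) (- sqrt 3 / 6), Complex (1 / 2) (- sqrt 3 / 6), Complex 0 (sqrt 3 / 3)}"

definition scaled_T0 :: "real \<Rightarrow> complex set" where
  "scaled_T0 t = homothety 0 t ` T0"

text \<open>In a triangular lattice \<open>N\<close> of minimal distance \<open>1\<close> (or its part inside a subdivided
  triangle), the unit triangles are spanned by three nodes at mutual distance \<open>1\<close>.\<close>

definition unit_triangles :: "complex set \<Rightarrow> complex set set" where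
  "unit_triangles N = {convex hull {u, v, w} | u v w. u \<in> N \<and> v \<in> N \<and> w \<in> N \<and> regular_corners 1 u v w}"

definition unit_edges :: "complex set \<Rightarrow> complex set set" where
  "unit_edges N = {closed_segment u v | u v w. u \<in> N \<and> v \<in> N \<and> w \<in> N \<and> regular_corners 1 u v w}"

text \<open>An edge in the interior of a triangle may have endpoints on the boundary.\<close>

definition edge_inside :: "complex set \<Rightarrow> complex set \<Rightarrow> bool" where
  "edge_inside e D \<longleftrightarrow> rel_interior e \<subseteq> interior D"

datatype colour = Red | Blue

fun opposite :: "colour \<Rightarrow> colour" where
  "opposite Red = Blue"
| "opposite Blue = Red"

datatype folding = Up | Down

datatype crease = Valley | Peak

fun crease_colour :: "crease \<Rightarrow> colour" where
  "crease_colour Valley = Red"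
| "crease_colour Peak = Blue"

text \<open>A folding bends every layer of the stack. The flag tells whether the upper side of the
  original sheet faces up in the layer: on a layer that has been turned over, a fold through the
  upper half-space bends the sheet away from its upper side, so it unfolds to a peak.\<close>

fun crease_of :: "folding \<Rightarrow> bool \<Rightarrow> crease" where
  "crease_of Up True = Valley"
| "crease_of Up False = Peak"
| "crease_of Down True = Peak"
| "crease_of Down False = Valley"

text \<open>The sides of \<open>t T\<^sub>0\<close> lie on the lines \<open>(x, \<xi>\<^sub>i) = t\<close>, and a point \<open>x\<close> is separated from
  \<open>t T\<^sub>0\<close> by that line iff \<open>(x, \<xi>\<^sub>i) / t > 1\<close>. The folding of \<open>-2t T\<^sub>0\<close> onto its central triangle
  \<open>t T\<^sub>0\<close> reflects each of the three corner triangles in the corresponding line; a point of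
  \<open>-2t T\<^sub>0\<close> lies beyond at most one of the lines.\<close>

definition mirror :: "real \<Rightarrow> nat \<Rightarrow> complex \<Rightarrow> complex" where
  "mirror t i x = x - (2 * (x \<bullet> xi i - t) / (xi i \<bullet> xi i)) *\<^sub>R xi i"

definition fold_map :: "real \<Rightarrow> complex \<Rightarrow> complex" where
  "fold_map t x =
    (if (x \<bullet> xi 1) / t > 1 then mirror t 1 x
     else if (x \<bullet> xi 2) / t > 1 then mirror t 2 x
     else if (x \<bullet> xi 3) / t > 1 then mirror t 3 x
     else x)"

text \<open>\<open>crease_at a m up e\<close>: the stack occupies \<open>(-2)\<^sup>m T\<^sub>0\<close>, the foldings \<open>a m, \<dots>, a 1\<close> are still
  to be performed in this order, and a unit edge of the sheet has currently position \<open>e\<close> in a layer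
  with facing \<open>up\<close>; the value is the kind of crease made along this edge, if any.\<close>

primrec crease_at :: "(nat \<Rightarrow> folding) \<Rightarrow> nat \<Rightarrow> bool \<Rightarrow> complex set \<Rightarrow> crease option" where
  "crease_at a 0 up e = None"
| "crease_at a (Suc m) up e =
    (if e \<subseteq> frontier (scaled_T0 ((-2) ^ m)) then Some (crease_of (a (Suc m)) up)
     else if e \<subseteq> scaled_T0 ((-2) ^ m) then crease_at a m up e
     else crease_at a m (\<not> up) (fold_map ((-2) ^ m) ` e))"

definition finite_pattern :: "(nat \<Rightarrow> folding) \<Rightarrow> nat \<Rightarrow> complex set \<Rightarrow> colour option" where
  "finite_pattern a m e = map_option crease_colour (crease_at a m True e)"

text \<open>Colourings are partial maps, defined exactly on the unit edges in question. Sequences of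
  foldings are indexed from \<open>1\<close>; the value \<open>a 0\<close> is never used.\<close>

definition folding_pattern :: "(nat \<Rightarrow> folding) \<Rightarrow> complex set \<Rightarrow> colour option" where
  "folding_pattern a e =
    (if e \<in> unit_edges grid_nodes
     then Some (THE c. \<forall>m. edge_inside e (scaled_T0 ((-2) ^ m)) \<longrightarrow> finite_pattern a m e = Some c)
     else None)"

text \<open>The intersection points of the lines subdividing a regular triangle of integer side.\<close>

definition subdivision_nodes :: "complex set \<Rightarrow> complex set" where
  "subdivision_nodes D = {v. \<exists>p q r (m::nat) i j l. regular_corners (real m) p q r
      \<and> D = convex hull {p, q, r} \<and> i + j + l = m
      \<and> v = (of_nat i * p + of_nat j * q + of_nat l * r) / of_nat m}"

type_synonym coloured_triangle = "complex set \<times> (complex set \<Rightarrow> colour option)"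

definition edge_coloured_triangle :: "coloured_triangle \<Rightarrow> bool" where
  "edge_coloured_triangle X \<longleftrightarrow>
     (\<exists>m::nat. regular_triangle (real m) (fst X))
     \<and> (positive_triangle (fst X) \<or> negative_triangle (fst X))
     \<and> dom (snd X) = unit_edges (subdivision_nodes (fst X))"

fun interior_colour :: "folding \<Rightarrow> bool \<Rightarrow> colour" where
  "interior_colour Up pos = (if pos then Blue else Red)"
| "interior_colour Down pos = (if pos then Red else Blue)"

text \<open>A unit edge of the doubled triangle is either half of the image of exactly one old unit edge, or
  an interior edge of the image of exactly one old unit triangle.\<close>

definition substitution :: "folding \<Rightarrow> coloured_triangle \<Rightarrow> coloured_triangle" where
  "substitution \<epsilon> X =
    (let D = fst X; h = homothety (center D) 2; N = subdivision_nodes D in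
      (h ` D,
       \<lambda>e'. if e' \<notin> unit_edges (subdivision_nodes (h ` D)) then None
            else if \<exists>e\<in>unit_edges N. e' \<subseteq> h ` e
              then map_option opposite (snd X (THE e. e \<in> unit_edges N \<and> e' \<subseteq> h ` e))
            else Some (interior_colour \<epsilon> (\<exists>\<tau>\<in>unit_triangles N. positive_triangle \<tau> \<and> e' \<subseteq> h ` \<tau>))))"

definition substitution_word :: "(nat \<Rightarrow> folding) \<Rightarrow> nat \<Rightarrow> coloured_triangle \<Rightarrow> coloured_triangle" where
  "substitution_word a k = foldr (\<lambda>i G. substitution (a i) \<circ> G) [1..<Suc k] id"

definition seed :: "folding \<Rightarrow> coloured_triangle" where
  "seed \<epsilon> = (T0, \<lambda>e. if e \<in> unit_edges (subdivision_nodes T0)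
                     then Some (case \<epsilon> of Up \<Rightarrow> Red | Down \<Rightarrow> Blue) else None)"

end

theory Submission
  imports Defs
begin

text \<open>Let \<open>\<rho>\<close> rotate a pattern by \<open>\<pi>\<close> about \<open>O\<close> and exchange the two colours. Unfolding the last
  folding \<open>a\<^sub>1\<close> shows that the pattern of \<open>(a\<^sub>1, a\<^sub>2, \<dots>)\<close> arises from the pattern of
  \<open>(a\<^sub>2, a\<^sub>3, \<dots>)\<close> by applying \<open>\<rho>\<close> and then the substitution of \<open>a\<^sub>1\<close>; since \<open>\<rho>\<close> commutes
  with substitutions and is an involution, it disappears after an even number of steps. The seed only
  influences the boundary.

  Both colourings are compared through a closed formula. An open unit edge lies on a line of
  \<open>(-2)\<^sup>j \<L>\<close> but not of \<open>(-2)\<^sup>j\<^sup>+\<^sup>1 \<L>\<close> for a unique \<open>j\<close>. Its crease is made by \<open>a\<^sub>j\<^sub>+\<^sub>1\<close>,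
  and its layer faces up at that time iff the triangle of \<open>(-2)\<^sup>j\<^sup>+\<^sup>1 \<L>\<close> around it is a translate
  of \<open>(-2)\<^sup>j\<^sup>+\<^sup>1 T\<^sub>0\<close>, because every reflection turns the layer over and exchanges the two
  orientations of the triangles of the finer grids.\<close>

declare One_nat_def [simp del]

section \<open>Coordinates and grid edges\<close>

definition coord :: "nat \<Rightarrow> complex \<Rightarrow> real" where
  "coord i p = p \<bullet> xi i"

lemma xi_explicit:
  "xi 1 = Complex 0 (- 2 * sqrt 3)" "xi 2 = Complex 3 (sqrt 3)" "xi 3 = Complex (- 3) (sqrt 3)"
proof -
  have c: "cos (4 * pi / 3) = - 1 / 2" "sin (4 * pi / 3) = - sqrt 3 / 2"
    using cos_periodic_pi[of "pi/3"] sin_periodic_pi[of "pi/3"] by (simp_all add: cos_60 sin_60 field_simps)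
  show "xi 1 = Complex 0 (- 2 * sqrt 3)"
    by (simp add: xi_def complex_eq_iff)
  show "xi 2 = Complex 3 (sqrt 3)"
    by (simp add: xi_def complex_eq_iff cos_120 sin_120)
  show "xi 3 = Complex (- 3) (sqrt 3)"
    by (simp add: xi_def complex_eq_iff c)
qed

lemma coord_explicit:
  "coord 1 p = - 2 * sqrt 3 * Im p" "coord 2 p = 3 * Re p + sqrt 3 * Im p"
  "coord 3 p = - 3 * Re p + sqrt 3 * Im p"
  unfolding coord_def xi_explicit by (simp_all add: inner_complex_def)

lemma coord_sum: "coord 1 p + coord 2 p + coord 3 p = 0"
  unfolding coord_explicit by simp

lemma coord_add [simp]: "coord i (p + q) = coord i p + coord i q"
  and coord_diff [simp]: "coord i (p - q) = coord i p - coord i q"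
  and coord_scaleR [simp]: "coord i (c *\<^sub>R p) = c * coord i p"
  and coord_zero [simp]: "coord i 0 = 0"
  by (simp_all add: coord_def inner_add_left inner_diff_left)

lemma coord_of_real_mult [simp]: "coord i (of_real c * p) = c * coord i p"
  using coord_scaleR[of i c p] by (simp add: scaleR_conv_of_real)

lemma coord_eqI:
  assumes "\<And>i. i \<in> {1, 2, 3} \<Longrightarrow> coord i p = coord i q"
  shows "p = q"
  using assms[of 1] assms[of 2] unfolding coord_explicit by (simp add: complex_eq_iff)

lemma coord_exists:
  assumes "x + y + z = 0"
  shows "\<exists>p. coord 1 p = x \<and> coord 2 p = y \<and> coord 3 p = z"
proof -
  define p where "p = Complex ((y - z) / 6) (- x / (2 * sqrt 3))"
  have "coord 1 p = x" "coord 2 p = y" "coord 3 p = z"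
    using assms unfolding coord_explicit p_def by (simp_all add: field_simps)
  then show ?thesis by blast
qed

text \<open>The \<open>xi i\<close> have squared length 12 and make angles of
  \<open>2 * pi / 3\<close>, so the squares of the three linear forms add up to 18 times the squared
  norm.\<close>

lemma dist_coord:
  "18 * (dist p q)\<^sup>2 = (coord 1 p - coord 1 q)\<^sup>2 + (coord 2 p - coord 2 q)\<^sup>2 + (coord 3 p - coord 3 q)\<^sup>2"
  unfolding dist_norm cmod_power2 coord_explicit by (simp add: power2_eq_square algebra_simps)

lemma dist_1_coord:
  "dist p q = 1 \<longleftrightarrow>
    (coord 1 p - coord 1 q)\<^sup>2 + (coord 2 p - coord 2 q)\<^sup>2 + (coord 3 p - coord 3 q)\<^sup>2 = 18"
  using dist_coord[of p q] power2_eq_1_iff[of "dist p q"] zero_le_dist[of p q] by auto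

text \<open>Nodes of the grid whose lines sit at levels congruent to \<open>s\<close> modulo 3. The
  offset is kept because the subdivision of \<open>2^m T0\<close> has offset \<open>2^m\<close>,
  which agrees modulo 3 with the offset 1 of \<open>L\<close> only for even
  \<open>m\<close>.\<close>

definition lattice :: "real \<Rightarrow> complex set" where
  "lattice s = {p. \<forall>i\<in>{1,2,3}. (coord i p - s) / 3 \<in> \<int>}"

lemma latticeD: "p \<in> lattice s \<Longrightarrow> i \<in> {1,2,3} \<Longrightarrow> (coord i p - s) / 3 \<in> \<int>"
  by (auto simp: lattice_def)

lemma abs_coord_diff:
  assumes "dist u v = 1" "i \<in> {1,2,3}"
  shows "\<bar>coord i u - coord i v\<bar> < 6"
proof -
  have "x\<^sup>2 + y\<^sup>2 + z\<^sup>2 = 18 \<Longrightarrow> x\<^sup>2 \<le> 18 \<and> y\<^sup>2 \<le> 18 \<and> z\<^sup>2 \<le> 18" for x y z :: real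
    by (smt (verit) zero_le_power2)
  then have "(coord i u - coord i v)\<^sup>2 \<le> 18"
    using assms dist_1_coord[of u v] by blast
  also have "\<dots> < 6\<^sup>2" by simp
  finally show ?thesis
    by (metis abs_le_square_iff abs_numeral not_le)
qed

lemma Ints_small_cases:
  fixes x :: real
  assumes "x \<in> \<int>" "\<bar>x\<bar> < 2"
  shows "x \<in> {-1, 0, 1}"
proof -
  obtain n where n: "x = of_int n" using assms by (auto elim: Ints_cases)
  then have "\<bar>n\<bar> < 2" using assms(2) by linarith
  then have "n = -1 \<or> n = 0 \<or> n = 1" by linarith
  then show ?thesis using n by auto
qed

text \<open>Differences of lattice levels are multiples of 3, and the square of each is at most 18,
  hence below 36.\<close>

lemma lattice_edge_coord:
  assumes "u \<in> lattice s" "v \<in> lattice s" "dist u v = 1" "i \<in> {1,2,3}"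
  shows "coord i u - coord i v \<in> {-3, 0, 3}"
proof -
  have "(coord i u - s) / 3 - (coord i v - s) / 3 \<in> \<int>"
    using assms latticeD by (intro Ints_diff) auto
  then have "(coord i u - coord i v) / 3 \<in> \<int>" by (simp add: field_simps)
  moreover have "\<bar>(coord i u - coord i v) / 3\<bar> < 2"
    using abs_coord_diff[OF assms(3,4)] by simp
  ultimately have "(coord i u - coord i v) / 3 \<in> {-1, 0, 1}" by (rule Ints_small_cases)
  then show ?thesis by auto
qed

lemma lattice_step:
  assumes "(x - s) / 3 \<in> \<int>" "(b - s) / 3 \<in> \<int>" "x < b + 3"
  shows "x \<le> (b::real)"
proof -
  have "(x - s) / 3 - (b - s) / 3 \<in> \<int>" using assms by (intro Ints_diff) auto
  then obtain n where n: "(x - s) / 3 - (b - s) / 3 = of_int n" by (auto elim: Ints_cases)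
  then have "x - b = 3 * of_int n" by (simp add: field_simps)
  then have "of_int n < (1::real)" using assms(3) by linarith
  then have "n \<le> 0" by linarith
  then have "of_int n \<le> (0::real)" by linarith
  then show ?thesis using \<open>x - b = _\<close> by linarith
qed

lemma coord_open_segment:
  assumes "p \<in> open_segment u v"
  obtains r where "0 < r" "r < 1" "p = (1 - r) *\<^sub>R u + r *\<^sub>R v"
    "\<And>i. coord i p = coord i u + r * (coord i v - coord i u)"
  using assms unfolding in_segment by (force simp: algebra_simps)

text \<open>A coordinate on the segment interpolates its values at the ends, which differ by 0 or by
  one gap of 3.\<close>

lemma open_edge_coord_cases:
  assumes "u \<in> lattice s" "v \<in> lattice s" "dist u v = 1" "p \<in> open_segment u v" "i \<in> {1,2,3}"
  shows "coord i u = coord i v \<and> coord i p = coord i u \<or>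
    coord i v = coord i u + 3 \<and> coord i u < coord i p \<and> coord i p < coord i u + 3 \<or>
    coord i v = coord i u - 3 \<and> coord i u > coord i p \<and> coord i p > coord i u - 3"
proof -
  obtain r where "0 < r" "r < 1" and r: "coord i p = coord i u + r * (coord i v - coord i u)"
    using coord_open_segment[OF assms(4)] by metis
  from lattice_edge_coord[OF assms(1,2,3,5)]
  consider "coord i v = coord i u + 3" | "coord i v = coord i u" | "coord i v = coord i u - 3"
    by fastforce
  then show ?thesis using r \<open>0 < r\<close> \<open>r < 1\<close> by cases auto
qed

text \<open>No line of the lattice crosses the relative interior of an edge.\<close>

lemma open_edge_le_iff:
  assumes "u \<in> lattice s" "v \<in> lattice s" "dist u v = 1" "p \<in> open_segment u v" "i \<in> {1,2,3}"
    and "(b - s) / 3 \<in> \<int>"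
  shows "coord i p \<le> b \<longleftrightarrow> coord i u \<le> b \<and> coord i v \<le> b"
    and "b \<le> coord i p \<longleftrightarrow> b \<le> coord i u \<and> b \<le> coord i v"
proof -
  note c = open_edge_coord_cases[OF assms(1-5)]
  note u = latticeD[OF assms(1,5)] and v = latticeD[OF assms(2,5)]
  have 1: "x \<le> b" if "x < b + 3" "x = coord i u \<or> x = coord i v" for x
    using lattice_step[of x s b] that u v assms(6) by auto
  have 2: "b \<le> x" if "b < x + 3" "x = coord i u \<or> x = coord i v" for x
    using lattice_step[of b s x] that u v assms(6) by auto
  show "coord i p \<le> b \<longleftrightarrow> coord i u \<le> b \<and> coord i v \<le> b"
    using c 1[of "coord i u"] 1[of "coord i v"] by auto
  show "b \<le> coord i p \<longleftrightarrow> b \<le> coord i u \<and> b \<le> coord i v"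
    using c 2[of "coord i u"] 2[of "coord i v"] by auto
qed

text \<open>The three differences lie in \<open>{-3, 0, 3}\<close> and add up to 0; without a zero
  among them the sum would be an odd multiple of 3.\<close>

lemma edge_parallel_to_side:
  assumes "u \<in> lattice s" "v \<in> lattice s" "dist u v = 1"
  shows "\<exists>i\<in>{1,2,3}. coord i u = coord i v"
proof -
  have "coord i u - coord i v \<in> {-3,0,3}" if "i \<in> {1,2,3}" for i
    using lattice_edge_coord[OF assms that] .
  from this[of 1] this[of 2] this[of 3] show ?thesis
    using coord_sum[of u] coord_sum[of v] by auto
qed

lemma open_edge_not_lattice:
  assumes "u \<in> lattice s" "v \<in> lattice s" "dist u v = 1" "p \<in> open_segment u v"
  shows "p \<notin> lattice s"
proof
  assume p: "p \<in> lattice s"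
  \<comment> \<open>If \<open>p\<close> were a node, \<open>coord i p\<close> would be a lattice
    level, and both equivalences at this level squeeze the two ends onto it.\<close>
  have "coord i u = coord i v" if i: "i \<in> {1,2,3}" for i
    using open_edge_le_iff[OF assms i latticeD[OF p i]] by auto
  then have "u = v" by (rule coord_eqI)
  then show False using assms(3) by simp
qed

text \<open>The three indices add up to \<open>- s\<close>, an integer, so integrality of two forces
  that of the third.\<close>

lemma lattice_two_coords:
  assumes s: "s \<in> \<int>" and "i \<in> {1,2,3}" "k \<in> {1,2,3}" "i \<noteq> k"
    "(coord i p - s) / 3 \<in> \<int>" "(coord k p - s) / 3 \<in> \<int>"
  shows "p \<in> lattice s"
proof -
  have e: "(coord 1 p - s)/3 + (coord 2 p - s)/3 + (coord 3 p - s)/3 = - s"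
    using coord_sum[of p] by (simp add: field_simps)
  have *: "x \<in> \<int> \<Longrightarrow> y \<in> \<int> \<Longrightarrow> x + y + z = - s \<Longrightarrow> z \<in> \<int>" for x y z :: real
    using s by (metis Ints_add Ints_diff Ints_minus add_diff_cancel_left')
  show ?thesis
    using assms(2-6) e *[of "(coord 1 p - s)/3" "(coord 2 p - s)/3" "(coord 3 p - s)/3"]
      *[of "(coord 1 p - s)/3" "(coord 3 p - s)/3" "(coord 2 p - s)/3"]
      *[of "(coord 2 p - s)/3" "(coord 3 p - s)/3" "(coord 1 p - s)/3"]
    unfolding lattice_def by (auto simp: ac_simps)
qed

lemma grid_nodes_eq_lattice: "grid_nodes = lattice 1"
proof -
  have l: "(\<exists>n. x \<in> grid_line i n) \<longleftrightarrow> (coord i x - 1) / 3 \<in> \<int>" for x i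
  proof
    assume "\<exists>n. x \<in> grid_line i n"
    then obtain n where "coord i x = 3 * of_int n + 1" by (auto simp: grid_line_def coord_def)
    then have "(coord i x - 1) / 3 = of_int n" by simp
    then show "(coord i x - 1) / 3 \<in> \<int>" by simp
  next
    assume "(coord i x - 1) / 3 \<in> \<int>"
    then obtain n where "(coord i x - 1) / 3 = of_int n" by (auto elim: Ints_cases)
    then have "x \<in> grid_line i n" by (simp add: grid_line_def coord_def field_simps)
    then show "\<exists>n. x \<in> grid_line i n" ..
  qed
  show ?thesis
  proof (intro equalityI subsetI)
    fix x assume "x \<in> grid_nodes"
    then show "x \<in> lattice 1" unfolding grid_nodes_def l
      using lattice_two_coords[of 1 _ _ x] Ints_1 by blast
  next
    fix x assume "x \<in> lattice 1"
    then show "x \<in> grid_nodes" unfolding grid_nodes_def l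
      using latticeD[of x 1 1] latticeD[of x 1 2] by force
  qed
qed

section \<open>The triangles \<open>t T0\<close> as intersections of half-planes\<close>

definition corner :: "nat \<Rightarrow> complex" where
  "corner i = (if i = 1 then Complex 0 (sqrt 3 / 3)
    else if i = 2 then Complex (- 1 / 2) (- sqrt 3 / 6) else Complex (1 / 2) (- sqrt 3 / 6))"

lemma corner_coord:
  "coord 1 (corner 1) = -2" "coord 2 (corner 1) = 1" "coord 3 (corner 1) = 1"
  "coord 1 (corner 2) = 1" "coord 2 (corner 2) = -2" "coord 3 (corner 2) = 1"
  "coord 1 (corner 3) = 1" "coord 2 (corner 3) = 1" "coord 3 (corner 3) = -2"
  unfolding coord_explicit by (simp_all add: corner_def)

lemma cell_hull:
  assumes u: "coord 1 u = x - 3" "coord 2 u = y" "coord 3 u = z"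
    and v: "coord 1 v = x" "coord 2 v = y - 3" "coord 3 v = z"
    and w: "coord 1 w = x" "coord 2 w = y" "coord 3 w = z - 3"
  shows "convex hull {u, v, w} = {p. coord 1 p \<le> x \<and> coord 2 p \<le> y \<and> coord 3 p \<le> z}"
proof (intro equalityI subsetI)
  fix p assume "p \<in> convex hull {u, v, w}"
  then obtain a b c where "0 \<le> a" "0 \<le> b" "0 \<le> c" "a + b + c = 1"
    and p: "p = a *\<^sub>R u + b *\<^sub>R v + c *\<^sub>R w" unfolding convex_hull_3 by blast
  moreover have "coord 1 p = (a + b + c) * x - 3 * a" "coord 2 p = (a + b + c) * y - 3 * b"
     "coord 3 p = (a + b + c) * z - 3 * c"
    by (simp_all add: p u v w algebra_simps)
  ultimately show "p \<in> {p. coord 1 p \<le> x \<and> coord 2 p \<le> y \<and> coord 3 p \<le> z}" by simp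
next
  fix p assume p: "p \<in> {p. coord 1 p \<le> x \<and> coord 2 p \<le> y \<and> coord 3 p \<le> z}"
  \<comment> \<open>Barycentric coordinates: the slack towards each side, divided by the height 3
    that the triangle has in these coordinates.\<close>
  define a b c where abc: "a = (x - coord 1 p) / 3" "b = (y - coord 2 p) / 3" "c = (z - coord 3 p) / 3"
  have xyz: "z = 3 - x - y" using coord_sum[of u] u by simp
  have s3: "coord 3 p = - coord 1 p - coord 2 p" using coord_sum[of p] by simp
  have 1: "a + b + c = 1" unfolding abc xyz s3 by (simp add: field_simps)
  have "p = a *\<^sub>R u + b *\<^sub>R v + c *\<^sub>R w"
  proof (rule coord_eqI)
    fix i :: nat assume "i \<in> {1,2,3}"
    moreover have "coord 1 (a *\<^sub>R u + b *\<^sub>R v + c *\<^sub>R w) = (a + b + c) * x - 3 * a"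
      "coord 2 (a *\<^sub>R u + b *\<^sub>R v + c *\<^sub>R w) = (a + b + c) * y - 3 * b"
      "coord 3 (a *\<^sub>R u + b *\<^sub>R v + c *\<^sub>R w) = (a + b + c) * z - 3 * c"
      by (simp_all add: u v w algebra_simps)
    moreover have "coord 1 p = x - 3 * a" "coord 2 p = y - 3 * b" "coord 3 p = z - 3 * c"
      by (simp_all add: abc field_simps)
    ultimately show "coord i p = coord i (a *\<^sub>R u + b *\<^sub>R v + c *\<^sub>R w)"
      unfolding 1 by auto
  qed
  moreover have "0 \<le> a" "0 \<le> b" "0 \<le> c" using p by (simp_all add: abc)
  ultimately show "p \<in> convex hull {u, v, w}" using 1 unfolding convex_hull_3 by blast
qed

lemma T0_coord: "T0 = {p. \<forall>i\<in>{1,2,3}. coord i p \<le> 1}"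
proof -
  have "T0 = convex hull {corner 1, corner 2, corner 3}"
    by (simp add: T0_def corner_def insert_commute)
  also have "\<dots> = {p. coord 1 p \<le> 1 \<and> coord 2 p \<le> 1 \<and> coord 3 p \<le> 1}"
    by (rule cell_hull) (simp_all add: corner_coord)
  finally show ?thesis by auto
qed

lemma scaled_T0_image: "scaled_T0 t = (*\<^sub>R) t ` T0"
  by (auto simp: scaled_T0_def homothety_def)

text \<open>Dividing by \<open>t\<close> serves both signs: for negative \<open>t\<close> the
  homothety includes a half-turn, and all inequalities reverse.\<close>

lemma scaled_T0_coord:
  assumes "t \<noteq> 0"
  shows "scaled_T0 t = {p. \<forall>i\<in>{1,2,3}. coord i p / t \<le> 1}"
proof (intro equalityI subsetI)
  fix p assume "p \<in> scaled_T0 t"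
  then show "p \<in> {p. \<forall>i\<in>{1,2,3}. coord i p / t \<le> 1}"
    using assms by (auto simp: scaled_T0_image T0_coord)
next
  fix p assume p: "p \<in> {p. \<forall>i\<in>{1,2,3}. coord i p / t \<le> 1}"
  then have "(1/t) *\<^sub>R p \<in> T0" by (simp add: T0_coord)
  moreover have "p = t *\<^sub>R ((1/t) *\<^sub>R p)" using assms by simp
  ultimately show "p \<in> scaled_T0 t" unfolding scaled_T0_image by blast
qed

lemma interior_scaled_T0:
  assumes "t \<noteq> 0"
  shows "interior (scaled_T0 t) = {p. \<forall>i\<in>{1,2,3}. coord i p / t < 1}"
proof -
  have h: "interior {p. coord i p / t \<le> 1} = {p. coord i p / t < 1}" if "i \<in> {1,2,3}" for i
  proof -
    have "coord i p / t = (xi i /\<^sub>R t) \<bullet> p" for p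
      by (simp add: coord_def inner_commute divide_inverse)
    moreover have "xi i /\<^sub>R t \<noteq> 0"
      using that assms xi_explicit by (auto simp: complex_eq_iff)
    ultimately show ?thesis using interior_halfspace_le[of "xi i /\<^sub>R t" 1] by simp
  qed
  have "scaled_T0 t = {p. coord 1 p / t \<le> 1} \<inter> ({p. coord 2 p / t \<le> 1} \<inter> {p. coord 3 p / t \<le> 1})"
    unfolding scaled_T0_coord[OF assms] by auto
  then show ?thesis using h[of 1] h[of 2] h[of 3] by (auto simp: interior_Int)
qed

lemma closed_scaled_T0: "closed (scaled_T0 t)"
  unfolding scaled_T0_image T0_def
  by (intro compact_imp_closed compact_scaling finite_imp_compact_convex_hull) auto

lemma frontier_scaled_T0:
  assumes "t \<noteq> 0"
  shows "frontier (scaled_T0 t) = {p \<in> scaled_T0 t. \<exists>i\<in>{1,2,3}. coord i p / t = 1}"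
proof -
  have "frontier (scaled_T0 t) = scaled_T0 t - {p. \<forall>i\<in>{1,2,3}. coord i p / t < 1}"
    by (simp add: frontier_def closure_closed[OF closed_scaled_T0] interior_scaled_T0[OF assms])
  then show ?thesis unfolding scaled_T0_coord[OF assms] by force
qed

section \<open>Creases of the folded sheet\<close>

text \<open>For \<open>s \<noteq> 0\<close> it takes the value \<open>n\<close> exactly on the image
  of \<open>grid_line i n\<close> under scaling by \<open>s\<close>; the sides of
  \<open>s T0\<close> have index 0.\<close>

definition line_index :: "real \<Rightarrow> nat \<Rightarrow> complex \<Rightarrow> real" where
  "line_index s i p = (coord i p / s - 1) / 3"

definition on_line :: "real \<Rightarrow> complex \<Rightarrow> bool" where
  "on_line s p \<longleftrightarrow> (\<exists>i\<in>{1,2,3}. line_index s i p \<in> \<int>)"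

text \<open>Off the lines, the sum of the rounded indices is 0 or 1: it is 0 exactly if the
  triangle of the grid \<open>s \<L>\<close> containing the point is a translate of \<open>s T\<^sub>0\<close>.\<close>

definition aligned :: "real \<Rightarrow> complex \<Rightarrow> bool" where
  "aligned s p \<longleftrightarrow> \<lceil>line_index s 1 p\<rceil> + \<lceil>line_index s 2 p\<rceil> + \<lceil>line_index s 3 p\<rceil> = 0"

lemma line_index_sum:
  assumes "s \<noteq> 0"
  shows "line_index s 1 p + line_index s 2 p + line_index s 3 p = - 1"
proof -
  have "line_index s 1 p + line_index s 2 p + line_index s 3 p
      = ((coord 1 p + coord 2 p + coord 3 p) / s - 3) / 3"
    by (simp add: line_index_def add_divide_distrib diff_divide_distrib)
  then show ?thesis by (simp only: coord_sum) simp
qed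

lemma line_index_scaleR: "c \<noteq> 0 \<Longrightarrow> line_index (c * s) i (c *\<^sub>R p) = line_index s i p"
  by (simp add: line_index_def)

lemma on_line_scaleR: "c \<noteq> 0 \<Longrightarrow> on_line (c * s) (c *\<^sub>R p) \<longleftrightarrow> on_line s p"
  by (simp add: on_line_def line_index_scaleR)

lemma aligned_scaleR: "c \<noteq> 0 \<Longrightarrow> aligned (c * s) (c *\<^sub>R p) \<longleftrightarrow> aligned s p"
  by (simp add: aligned_def line_index_scaleR)

text \<open>Since \<open>-2 * (3 * n + 1) = 3 * (-2 * n - 1) + 1\<close>, a coarse line of index
  \<open>n\<close> is a fine line of index \<open>-2 * n - 1\<close>. The factor 2 would not respect
  the offset 1.\<close>

lemma on_line_coarser:
  assumes "on_line (- 2 * s) p"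
  shows "on_line s p"
proof -
  obtain i where i: "i \<in> {1,2,3}" "line_index (- 2 * s) i p \<in> \<int>"
    using assms by (auto simp: on_line_def)
  have "line_index s i p = - 2 * line_index (- 2 * s) i p - 1"
    by (simp add: line_index_def field_simps)
  also have "\<dots> \<in> \<int>" using i by auto
  finally show ?thesis using i by (auto simp: on_line_def)
qed

lemma on_line_power_mono:
  assumes "on_line ((-2) ^ j) p" "i \<le> j"
  shows "on_line ((-2) ^ i) p"
  using assms(2,1)
proof (induction rule: inc_induct)
  case (step n)
  then show ?case using on_line_coarser[of "(-2) ^ n" p] by simp
qed

text \<open>-2 is congruent to 1 modulo 3. Hence the sides of every \<open>(-2)^m T0\<close> lie on
  lines of \<open>L\<close>.\<close>

lemma Ints_power_minus_2: "((-2) ^ m - 1) / 3 \<in> (\<int> :: real set)"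
proof (induction m)
  case (Suc m)
  have "((-2) ^ Suc m - 1) / 3 = - 2 * (((-2) ^ m - 1) / 3) - (1 :: real)" by (simp add: field_simps)
  also have "\<dots> \<in> \<int>" using Suc by (intro Ints_diff Ints_mult) auto
  finally show ?case .
qed simp

text \<open>All three indices are negative inside and they add up to \<open>-1\<close>, so none can
  reach \<open>-1\<close>.\<close>

lemma interior_line_index:
  assumes "t \<noteq> 0" "p \<in> interior (scaled_T0 t)" "i \<in> {1,2,3}"
  shows "- 1 < line_index t i p" "line_index t i p < 0"
proof -
  have neg: "line_index t k p < 0" if "k \<in> {1,2,3}" for k
    using assms that by (auto simp: interior_scaled_T0 line_index_def)
  show "line_index t i p < 0" using neg assms(3) .
  show "- 1 < line_index t i p"
    using neg[of 1] neg[of 2] neg[of 3] line_index_sum[OF assms(1), of p] assms(3) by auto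
qed

lemma between_not_Ints: "- 1 < x \<Longrightarrow> x < 0 \<Longrightarrow> (x::real) \<notin> \<int>"
  by (auto elim!: Ints_cases)

lemma interior_not_on_line:
  assumes "t \<noteq> 0" "p \<in> interior (scaled_T0 t)"
  shows "\<not> on_line t p"
  using interior_line_index[OF assms] between_not_Ints unfolding on_line_def by blast

lemma interior_aligned:
  assumes "t \<noteq> 0" "p \<in> interior (scaled_T0 t)"
  shows "aligned t p"
proof -
  have "\<lceil>line_index t i p\<rceil> = 0" if "i \<in> {1,2,3}" for i
    using interior_line_index[OF assms that] by (simp add: ceiling_eq_iff)
  then show ?thesis by (simp add: aligned_def)
qed

section \<open>Reflections in grid lines\<close>

lemma index_completion:
  assumes "i \<in> {1,2,3::nat}"
  obtains k l where "{1,2,3} = {i,k,l}" "i \<noteq> k" "i \<noteq> l" "k \<noteq> l"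
proof -
  from assms consider "i = 1" | "i = 2" | "i = 3" by auto
  then show ?thesis by cases (rule that[of 2 3] that[of 1 3] that[of 1 2]; auto)+
qed

text \<open>Lets an argument single out a direction \<open>i\<close> with the two others
  \<open>k\<close> and \<open>l\<close>, instead of treating three symmetric cases.\<close>

lemma sum_indices:
  fixes f :: "nat \<Rightarrow> 'a::comm_monoid_add"
  assumes "{1,2,3} = {i,k,l}" "i \<noteq> k" "i \<noteq> l" "k \<noteq> l"
  shows "f 1 + f 2 + f 3 = f i + f k + f l"
proof -
  have "(\<Sum>j\<in>{1,2,3}. f j) = (\<Sum>j\<in>{i,k,l}. f j)" using assms by simp
  then show ?thesis using assms(2-4) by (simp add: add.assoc)
qed

lemma coord_xi: "i \<in> {1,2,3} \<Longrightarrow> k \<in> {1,2,3} \<Longrightarrow> coord k (xi i) = (if k = i then 12 else - 6)"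
  by (auto simp: coord_explicit xi_explicit)

lemma coord_mirror:
  assumes "i \<in> {1,2,3}" "k \<in> {1,2,3}"
  shows "coord k (mirror t i p) = (if k = i then 2 * t - coord i p else coord k p + coord i p - t)"
proof -
  have "xi i \<bullet> xi i = 12" using coord_xi[OF assms(1,1)] by (simp add: coord_def)
  then have "mirror t i p = p - ((coord i p - t) / 6) *\<^sub>R xi i"
    by (simp add: mirror_def coord_def)
  then have "coord k (mirror t i p) = coord k p - (coord i p - t) / 6 * coord k (xi i)" by simp
  then show ?thesis using coord_xi[OF assms] by (cases "k = i") (auto simp: field_simps)
qed

lemma mirror_mirror:
  assumes "i \<in> {1,2,3}"
  shows "mirror t i (mirror t i p) = p"
proof (rule coord_eqI)
  fix k :: nat assume "k \<in> {1,2,3}"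
  note c = coord_mirror[OF assms this] coord_mirror[OF assms assms]
  show "coord k (mirror t i (mirror t i p)) = coord k p" unfolding c by simp
qed

text \<open>Reversing direction \<open>i\<close> exchanges the other two up to sign and shift, since
  the coordinates add up to 0.\<close>

lemma line_index_mirror:
  assumes "{1,2,3} = {i,k,l}" "i \<noteq> k" "i \<noteq> l" "k \<noteq> l" "s \<noteq> 0"
  shows "line_index s i (mirror t i p) = 2 * ((t / s - 1) / 3) - line_index s i p"
    and "line_index s k (mirror t i p) = - 1 - (t / s - 1) / 3 - line_index s l p"
proof -
  have m: "i \<in> {1,2,3}" "k \<in> {1,2,3}" unfolding assms(1) by auto
  show "line_index s i (mirror t i p) = 2 * ((t / s - 1) / 3) - line_index s i p"
    using m assms(5) by (simp add: line_index_def coord_mirror field_simps)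
  have "coord i p + coord k p + coord l p = 0"
    using sum_indices[OF assms(1-4), of "\<lambda>j. coord j p"] coord_sum[of p] by simp
  then have l: "coord l p = - coord i p - coord k p" by simp
  show "line_index s k (mirror t i p) = - 1 - (t / s - 1) / 3 - line_index s l p"
    using m assms(2,5) unfolding line_index_def l by (simp add: coord_mirror field_simps)
qed

text \<open>The premise on \<open>t / s\<close> says that the mirror is itself a line of
  \<open>s L\<close>, so the indices are permuted up to sign and integer shifts; the converse
  follows because a reflection is an involution.\<close>

lemma on_line_mirror:
  assumes i: "i \<in> {1,2,3}" and s: "s \<noteq> 0" and t: "(t / s - 1) / 3 \<in> \<int>"
  shows "on_line s (mirror t i p) \<longleftrightarrow> on_line s p"
proof -
  have imp: "on_line s (mirror t i p)" if "on_line s p" for p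
  proof -
    obtain k l where kl: "{1,2,3} = {i,k,l}" "i \<noteq> k" "i \<noteq> l" "k \<noteq> l"
      using index_completion[OF i] by metis
    then have lk: "{1,2,3} = {i,l,k}" by auto
    from that consider "line_index s i p \<in> \<int>" | "line_index s k p \<in> \<int>" | "line_index s l p \<in> \<int>"
      unfolding on_line_def kl(1) by auto
    then show ?thesis
    proof cases
      case 1
      then have "line_index s i (mirror t i p) \<in> \<int>"
        unfolding line_index_mirror(1)[OF kl s] using t by (intro Ints_diff Ints_mult) auto
      then show ?thesis using i by (auto simp: on_line_def)
    next
      case 2
      then have "line_index s l (mirror t i p) \<in> \<int>"
        unfolding line_index_mirror(2)[OF lk kl(3,2) kl(4)[symmetric] s] using t by (intro Ints_diff) auto
      then show ?thesis unfolding on_line_def kl(1) by auto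
    next
      case 3
      then have "line_index s k (mirror t i p) \<in> \<int>"
        unfolding line_index_mirror(2)[OF kl s] using t by (intro Ints_diff) auto
      then show ?thesis unfolding on_line_def kl(1) by auto
    qed
  qed
  show ?thesis using imp[of p] imp[of "mirror t i p"] mirror_mirror[OF i] by auto
qed

text \<open>Reversing the sign turns ceilings into floors, and off the integers the floor is the
  ceiling minus 1; hence the summand 1.\<close>

lemma ceiling_Ints_diff:
  fixes r x :: real
  assumes "r \<in> \<int>" "x \<notin> \<int>"
  shows "of_int \<lceil>r - x\<rceil> = r - of_int \<lceil>x\<rceil> + 1"
proof -
  obtain n where n: "r = of_int n" using assms by (auto elim: Ints_cases)
  have "\<lceil>r - x\<rceil> = n - \<lfloor>x\<rfloor>"
    unfolding n by (metis ceiling_def floor_diff_of_int minus_diff_eq add.inverse_inverse)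
  moreover have "\<lceil>x\<rceil> = \<lfloor>x\<rfloor> + 1" using assms(2) by (metis ceiling_altdef Ints_of_int)
  ultimately show ?thesis using n by simp
qed

text \<open>The indices add up to \<open>-1\<close>, and off the lines each ceiling exceeds its
  index by more than 0 and less than 1, so the sum of the ceilings is strictly between -1 and
  2.\<close>

lemma aligned_cases:
  assumes "s \<noteq> 0" "\<not> on_line s p"
  shows "\<lceil>line_index s 1 p\<rceil> + \<lceil>line_index s 2 p\<rceil> + \<lceil>line_index s 3 p\<rceil> \<in> {0, 1}"
proof -
  have "line_index s i p \<noteq> of_int \<lceil>line_index s i p\<rceil>" if "i \<in> {1,2,3}" for i
    using assms(2) that unfolding on_line_def by (metis Ints_of_int)
  from this[of 1] this[of 2] this[of 3]
  have "line_index s 1 p < of_int \<lceil>line_index s 1 p\<rceil>" "line_index s 2 p < of_int \<lceil>line_index s 2 p\<rceil>"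
    "line_index s 3 p < of_int \<lceil>line_index s 3 p\<rceil>"
    using le_of_int_ceiling[of "line_index s 1 p"] le_of_int_ceiling[of "line_index s 2 p"]
      le_of_int_ceiling[of "line_index s 3 p"] by (simp_all add: less_le)
  then show ?thesis using line_index_sum[OF assms(1), of p]
     ceiling_correct[of "line_index s 1 p"] ceiling_correct[of "line_index s 2 p"]
     ceiling_correct[of "line_index s 3 p"] by simp linarith
qed

text \<open>In the sum of the rounded reflected indices the shifts \<open>2 * r\<close>,
  \<open>- r\<close>, \<open>- r\<close> cancel and the constants leave 1. Thus a sum
  \<open>S\<close> becomes \<open>1 - S\<close>, which exchanges its two possible values.\<close>

lemma aligned_mirror:
  assumes i: "i \<in> {1,2,3}" and s: "s \<noteq> 0" and t: "(t / s - 1) / 3 \<in> \<int>" and p: "\<not> on_line s p"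
  shows "aligned s (mirror t i p) \<longleftrightarrow> \<not> aligned s p"
proof -
  obtain k l where kl: "{1,2,3} = {i,k,l}" "i \<noteq> k" "i \<noteq> l" "k \<noteq> l"
    using index_completion[OF i] by metis
  then have lk: "{1,2,3} = {i,l,k}" by auto
  define r where "r = (t / s - 1) / 3"
  have r: "r \<in> \<int>" using t by (simp add: r_def)
  have n: "line_index s i p \<notin> \<int>" "line_index s k p \<notin> \<int>" "line_index s l p \<notin> \<int>"
    using p unfolding on_line_def kl(1) by auto
  have "real_of_int \<lceil>line_index s i (mirror t i p)\<rceil> = 2 * r - of_int \<lceil>line_index s i p\<rceil> + 1"
    unfolding line_index_mirror(1)[OF kl s] r_def[symmetric] by (rule ceiling_Ints_diff) (use r n in auto)
  moreover have "real_of_int \<lceil>line_index s k (mirror t i p)\<rceil> = - 1 - r - of_int \<lceil>line_index s l p\<rceil> + 1"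
    unfolding line_index_mirror(2)[OF kl s] r_def[symmetric] by (rule ceiling_Ints_diff) (use r n in auto)
  moreover have "real_of_int \<lceil>line_index s l (mirror t i p)\<rceil> = - 1 - r - of_int \<lceil>line_index s k p\<rceil> + 1"
    unfolding line_index_mirror(2)[OF lk kl(3,2) kl(4)[symmetric] s] r_def[symmetric]
    by (rule ceiling_Ints_diff) (use r n in auto)
  ultimately have "\<lceil>line_index s i (mirror t i p)\<rceil> + \<lceil>line_index s k (mirror t i p)\<rceil> + \<lceil>line_index s l (mirror t i p)\<rceil>
    = 1 - (\<lceil>line_index s i p\<rceil> + \<lceil>line_index s k p\<rceil> + \<lceil>line_index s l p\<rceil>)" by linarith
  then show ?thesis
    using aligned_cases[OF s p] sum_indices[OF kl, of "\<lambda>j. \<lceil>line_index s j p\<rceil>"]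
      sum_indices[OF kl, of "\<lambda>j. \<lceil>line_index s j (mirror t i p)\<rceil>"]
    by (auto simp: aligned_def)
qed

lemma dist_mirror:
  assumes i: "i \<in> {1,2,3}"
  shows "dist (mirror t i p) (mirror t i q) = dist p q"
proof -
  obtain k l where kl: "{1,2,3} = {i,k,l}" "i \<noteq> k" "i \<noteq> l" "k \<noteq> l"
    using index_completion[OF i] by metis
  have d: "18 * (dist p q)\<^sup>2 = (coord i p - coord i q)\<^sup>2 + (coord k p - coord k q)\<^sup>2 + (coord l p - coord l q)\<^sup>2" for p q
    using dist_coord[of p q] sum_indices[OF kl, of "\<lambda>j. (coord j p - coord j q)\<^sup>2"] by simp
  have l: "coord l p = - coord i p - coord k p" for p
    using sum_indices[OF kl, of "\<lambda>j. coord j p"] coord_sum[of p] by simp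
  have m: "k \<in> {1,2,3}" "l \<in> {1,2,3}" unfolding kl(1) by auto
  have "18 * (dist (mirror t i p) (mirror t i q))\<^sup>2 = 18 * (dist p q)\<^sup>2"
    unfolding d coord_mirror[OF i i] coord_mirror[OF i m(1)] coord_mirror[OF i m(2)]
    using kl(2,3) by (simp add: l[of p] l[of q] power2_eq_square algebra_simps)
  then show ?thesis by simp
qed

lemma mirror_closed_segment: "mirror t i ` closed_segment u v = closed_segment (mirror t i u) (mirror t i v)"
  and mirror_open_segment: "p \<in> open_segment u v \<Longrightarrow> i \<in> {1,2,3} \<Longrightarrow> mirror t i p \<in> open_segment (mirror t i u) (mirror t i v)"
proof -
  have c: "mirror t i ((1 - r) *\<^sub>R u + r *\<^sub>R v) = (1 - r) *\<^sub>R mirror t i u + r *\<^sub>R mirror t i v" for r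
    unfolding mirror_def by (simp add: inner_add_left inner_diff_left algebra_simps add_divide_distrib diff_divide_distrib)
  show "mirror t i ` closed_segment u v = closed_segment (mirror t i u) (mirror t i v)"
    unfolding closed_segment_def using c by (auto simp: image_iff) metis+
  show "mirror t i p \<in> open_segment (mirror t i u) (mirror t i v)" if "p \<in> open_segment u v" "i \<in> {1,2,3}"
    using that c mirror_mirror[OF that(2), of t] unfolding in_segment by metis
qed

lemma mirror_lattice:
  assumes i: "i \<in> {1,2,3}" and t: "(t - 1) / 3 \<in> \<int>" and "p \<in> lattice 1"
  shows "mirror t i p \<in> lattice 1"
proof -
  have z: "(coord k q - 1) / 3 = line_index 1 k q" for k q by (simp add: line_index_def)
  obtain k l where kl: "{1,2,3} = {i,k,l}" "i \<noteq> k" "i \<noteq> l" "k \<noteq> l"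
    using index_completion[OF i] by metis
  then have lk: "{1,2,3} = {i,l,k}" by auto
  have n: "line_index 1 i p \<in> \<int>" "line_index 1 k p \<in> \<int>" "line_index 1 l p \<in> \<int>"
     "2 * ((t - 1) / 3) \<in> \<int>"
    using assms(3) Ints_mult[OF _ t, of 2] unfolding lattice_def kl(1) z by auto
  have "line_index 1 i (mirror t i p) \<in> \<int>"
    unfolding line_index_mirror(1)[OF kl one_neq_zero] div_by_1 using n by (intro Ints_diff)
  moreover have "line_index 1 k (mirror t i p) \<in> \<int>"
    unfolding line_index_mirror(2)[OF kl one_neq_zero] div_by_1 using n t by (intro Ints_diff) auto
  moreover have "line_index 1 l (mirror t i p) \<in> \<int>"
    unfolding line_index_mirror(2)[OF lk kl(3,2) kl(4)[symmetric] one_neq_zero] div_by_1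
    using n t by (intro Ints_diff) auto
  ultimately show ?thesis unfolding lattice_def kl(1) z by simp
qed

section \<open>Edges under one folding\<close>

lemma open_edge_scaled_iff:
  assumes "u \<in> lattice 1" "v \<in> lattice 1" "dist u v = 1" "p \<in> open_segment u v" "i \<in> {1,2,3}"
    and "(t - 1) / 3 \<in> \<int>" "t \<noteq> 0"
  shows "coord i p / t \<le> 1 \<longleftrightarrow> coord i u / t \<le> 1 \<and> coord i v / t \<le> 1"
    and "1 \<le> coord i p / t \<longleftrightarrow> 1 \<le> coord i u / t \<and> 1 \<le> coord i v / t"
proof -
  have d: "x / t \<le> 1 \<longleftrightarrow> (if 0 < t then x \<le> t else t \<le> x)" "1 \<le> x / t \<longleftrightarrow> (if 0 < t then t \<le> x else x \<le> t)" for x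
    using \<open>t \<noteq> 0\<close> by (simp_all add: divide_le_eq_1 le_divide_eq_1)
  note e = open_edge_le_iff[OF assms(1-6)]
  show "coord i p / t \<le> 1 \<longleftrightarrow> coord i u / t \<le> 1 \<and> coord i v / t \<le> 1"
    "1 \<le> coord i p / t \<longleftrightarrow> 1 \<le> coord i u / t \<and> 1 \<le> coord i v / t"
    unfolding d e by simp_all
qed

text \<open>The sides of \<open>t T0\<close> lie on grid lines, which never cross an open edge;
  hence a single point of it decides the conditions on whole edges in
  \<open>crease_at\<close>.\<close>

lemma closed_edge_subset_scaled_iff:
  assumes "u \<in> lattice 1" "v \<in> lattice 1" "dist u v = 1" "p \<in> open_segment u v"
    and "(t - 1) / 3 \<in> \<int>" "t \<noteq> 0"
  shows "closed_segment u v \<subseteq> scaled_T0 t \<longleftrightarrow> p \<in> scaled_T0 t"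
    and "closed_segment u v \<subseteq> frontier (scaled_T0 t) \<longleftrightarrow> p \<in> frontier (scaled_T0 t)"
proof -
  have conv: "convex (scaled_T0 t)"
    unfolding scaled_T0_image T0_def by (intro convex_scaling convex_convex_hull)
  have p: "p \<in> closed_segment u v" using assms(4) open_closed_segment by blast
  show 1: "closed_segment u v \<subseteq> scaled_T0 t \<longleftrightarrow> p \<in> scaled_T0 t"
  proof
    assume "p \<in> scaled_T0 t"
    then have "u \<in> scaled_T0 t" "v \<in> scaled_T0 t"
      unfolding scaled_T0_coord[OF assms(6)] using open_edge_scaled_iff(1)[OF assms(1-4) _ assms(5,6)] by auto
    then show "closed_segment u v \<subseteq> scaled_T0 t" using conv by (simp add: closed_segment_subset)
  qed (use p in blast)
  show "closed_segment u v \<subseteq> frontier (scaled_T0 t) \<longleftrightarrow> p \<in> frontier (scaled_T0 t)"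
  proof
    assume f: "p \<in> frontier (scaled_T0 t)"
    then have sub: "closed_segment u v \<subseteq> scaled_T0 t" using 1 frontier_scaled_T0[OF assms(6)] by auto
    obtain i where i: "i \<in> {1,2,3}" "coord i p / t = 1"
      using f frontier_scaled_T0[OF assms(6)] by auto
    then have "coord i u = t" "coord i v = t"
      using open_edge_scaled_iff[OF assms(1-4) i(1) assms(5,6)] assms(6) by (auto simp: field_simps)
    then have "coord i x = t" if x: "x \<in> closed_segment u v" for x
    proof -
      obtain r where "x = (1 - r) *\<^sub>R u + r *\<^sub>R v" using x unfolding in_segment by blast
      then have "coord i x = (1 - r) * t + r * t" by (simp add: \<open>coord i u = t\<close> \<open>coord i v = t\<close>)
      then show ?thesis by (simp add: algebra_simps)
    qed
    then show "closed_segment u v \<subseteq> frontier (scaled_T0 t)"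
      unfolding frontier_scaled_T0[OF assms(6)] using sub i(1) assms(6) by auto
  qed (use p in blast)
qed

text \<open>Inside \<open>-2t T0\<close> the coordinates divided by \<open>t\<close> are at least -2
  and add up to 0, so at most one exceeds 1 and the first test of \<open>fold_map\<close> that
  succeeds is the right one. The premise admits 1 itself, where the reflection fixes the point, to
  cover endpoints on the fold line.\<close>

lemma fold_map_eq_mirror:
  assumes t: "t \<noteq> 0" and x: "x \<in> scaled_T0 (- 2 * t)" and i: "i \<in> {1,2,3}" and "1 \<le> coord i x / t"
  shows "fold_map t x = mirror t i x"
proof -
  have t': "- 2 * t \<noteq> 0" using t by simp
  have "coord k x / (- 2 * t) \<le> 1" if "k \<in> {1,2,3}" for k
    using x that unfolding scaled_T0_coord[OF t'] by blast
  moreover have "coord k x / (- 2 * t) = - (coord k x / t) / 2" for k by simp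
  ultimately have ge: "- 2 \<le> coord k x / t" if "k \<in> {1,2,3}" for k
    using that by fastforce
  have sum: "coord 1 x / t + coord 2 x / t + coord 3 x / t = 0"
    using coord_sum[of x] by (metis add_divide_distrib div_0)
  have "coord k x / t \<le> 1" if "k \<in> {1,2,3}" "k \<noteq> i" for k
    using that i assms(4) ge[of 1] ge[of 2] ge[of 3] sum by auto
  moreover have "mirror t i x = x" if "coord i x / t = 1"
    using that t by (simp add: mirror_def coord_def)
  ultimately show ?thesis
    using i assms(4) unfolding fold_map_def coord_def by force
qed

text \<open>With \<open>c\<close> for the coordinates divided by \<open>t\<close>, the image has
  coordinates \<open>2 - c i\<close>, \<open>- c l - 1\<close> and \<open>- c k - 1\<close>, all
  below 1 since \<open>c i\<close> exceeds 1 and the others exceed -2.\<close>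

lemma mirror_interior:
  assumes t: "t \<noteq> 0" and x: "x \<in> interior (scaled_T0 (- 2 * t))" and i: "i \<in> {1,2,3}" and "1 < coord i x / t"
  shows "mirror t i x \<in> interior (scaled_T0 t)"
proof -
  obtain k l where kl: "{1,2,3} = {i,k,l}" "i \<noteq> k" "i \<noteq> l" "k \<noteq> l"
    using index_completion[OF i] by metis
  have m: "k \<in> {1,2,3}" "l \<in> {1,2,3}" unfolding kl(1) by auto
  have t': "- 2 * t \<noteq> 0" using t by simp
  have "coord k x / (- 2 * t) < 1" if "k \<in> {1,2,3}" for k
    using x that unfolding interior_scaled_T0[OF t'] by blast
  moreover have "coord k x / (- 2 * t) = - (coord k x / t) / 2" for k by simp
  ultimately have ge: "- 2 < coord k x / t" if "k \<in> {1,2,3}" for k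
    using that by fastforce
  have sum: "coord i x / t + coord k x / t + coord l x / t = 0"
    using sum_indices[OF kl, of "\<lambda>j. coord j x"] coord_sum[of x] by (metis add_divide_distrib div_0)
  have "coord i (mirror t i x) / t = 2 - coord i x / t"
    "coord k (mirror t i x) / t = coord k x / t + coord i x / t - 1"
    "coord l (mirror t i x) / t = coord l x / t + coord i x / t - 1"
    unfolding coord_mirror[OF i i] coord_mirror[OF i m(1)] coord_mirror[OF i m(2)]
    using t kl by (auto simp: field_simps)
  then show ?thesis unfolding interior_scaled_T0[OF t] kl(1)
    using sum ge[OF m(1)] ge[OF m(2)] assms(4) by auto
qed

text \<open>Induction over the foldings still to come, for all edges and both facings. The point
  \<open>p\<close> stands for the whole edge, and a reflection negates \<open>up\<close> together
  with the alignment, so their equality is invariant.\<close>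

lemma crease_at_edge:
  assumes "u \<in> lattice 1" "v \<in> lattice 1" "dist u v = 1" "p \<in> open_segment u v"
    and "p \<in> interior (scaled_T0 ((-2) ^ m))"
    and "on_line ((-2) ^ j) p" "\<not> on_line ((-2) ^ Suc j) p"
  shows "crease_at a m up (closed_segment u v) =
    Some (crease_of (a (Suc j)) (aligned ((-2) ^ Suc j) p = up))"
  using assms
proof (induction m arbitrary: u v p up)
  case 0
  \<comment> \<open>No grid line meets the interior of \<open>T0\<close>, so the premises are
    contradictory.\<close>
  then have "\<not> on_line ((-2) ^ 0) p" by (intro interior_not_on_line) auto
  then show ?case using on_line_power_mono[OF 0(6), of 0] by simp
next
  case (Suc m)
  let ?t = "(-2) ^ m :: real"
  have t: "?t \<noteq> 0" "(?t - 1) / 3 \<in> \<int>" using Ints_power_minus_2 by auto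
  have int: "p \<in> interior (scaled_T0 (- 2 * ?t))" using Suc.prems(5) by simp
  note sub = closed_edge_subset_scaled_iff[OF Suc.prems(1-4) t(2,1)]
  have "\<not> on_line ((-2) ^ Suc m) p" using interior_not_on_line[OF _ Suc.prems(5)] by simp
  then have "j < Suc m" using on_line_power_mono[OF Suc.prems(6)] by (meson not_less)
  show ?case
  proof (cases "p \<in> scaled_T0 ?t")
    case True
    show ?thesis
    proof (cases "p \<in> frontier (scaled_T0 ?t)")
      case True
      \<comment> \<open>The edge lies on the fold being made: its level is \<open>m\<close>, and
        \<open>p\<close>, being inside \<open>(-2)^(m+1) T0\<close>, is aligned at the next level,
        so the crease depends on \<open>up\<close> alone.\<close>
      then obtain i where "i \<in> {1,2,3}" "coord i p / ?t = 1" using frontier_scaled_T0[OF t(1)] by auto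
      then have "line_index ?t i p = 0" unfolding line_index_def by (metis diff_self div_0)
      then have "on_line ?t p" using \<open>i \<in> {1,2,3}\<close> unfolding on_line_def by (metis Ints_0)
      then have "\<not> Suc j \<le> m" using on_line_power_mono Suc.prems(7) by blast
      then have "j = m" using \<open>j < Suc m\<close> by simp
      moreover have "aligned ((-2) ^ Suc m) p" using interior_aligned[OF _ Suc.prems(5)] by simp
      ultimately show ?thesis using True sub by simp
    next
      case False
      then have "p \<in> interior (scaled_T0 ?t)" using True closed_scaled_T0 by (simp add: frontier_def)
      then show ?thesis using Suc.IH[OF Suc.prems(1-4) _ Suc.prems(6,7), of up] False True sub by simp
    qed
  next
    case False
    then obtain i where i: "i \<in> {1,2,3}" and pi: "1 < coord i p / ?t"
      unfolding scaled_T0_coord[OF t(1)] by force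
    let ?M = "mirror ?t i"
    have r: "(?t / (-2) ^ l - 1) / 3 \<in> \<int>" if "l \<le> m" for l
      using Ints_power_minus_2[of "m - l"] that by (simp add: power_diff)
    \<comment> \<open>The image of \<open>p\<close> lies inside \<open>(-2)^m T0\<close>, off the
      lines of that level; reflecting back, so is \<open>p\<close>. Thus its crease belongs to a
      later folding, and the mirror is a line of all the grids concerned.\<close>
    have "\<not> on_line ?t p"
      using interior_not_on_line[OF t(1) mirror_interior[OF t(1) int i pi]] on_line_mirror[OF i t(1) r] by simp
    then have "j < m" using on_line_power_mono[OF Suc.prems(6)] by (meson not_less)
    have "p \<notin> frontier (scaled_T0 ?t)" using False frontier_scaled_T0[OF t(1)] by auto
    then have "crease_at a (Suc m) up (closed_segment u v)
        = crease_at a m (\<not> up) (fold_map ?t ` closed_segment u v)"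
      using False sub by simp
    also have "fold_map ?t ` closed_segment u v = ?M ` closed_segment u v"
    proof (rule image_cong[OF refl])
      fix x assume x: "x \<in> closed_segment u v"
      have "closed_segment u v \<subseteq> scaled_T0 ((-2) ^ Suc m)"
        using closed_edge_subset_scaled_iff(1)[OF Suc.prems(1-4) Ints_power_minus_2, of "Suc m"] Suc.prems(5)
         interior_subset by auto
      then have 1: "x \<in> scaled_T0 (- 2 * ?t)" using x by auto
      have "1 \<le> coord i u / ?t" "1 \<le> coord i v / ?t"
        using open_edge_scaled_iff(2)[OF Suc.prems(1-4) i t(2,1)] pi by auto
      moreover obtain r where "0 \<le> r" "r \<le> 1" "x = (1 - r) *\<^sub>R u + r *\<^sub>R v"
        using x unfolding in_segment by blast
      moreover have "coord i x / ?t = (1 - r) * (coord i u / ?t) + r * (coord i v / ?t)"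
        using \<open>x = _\<close> by (simp add: add_divide_distrib)
      \<comment> \<open>The convexity bound is applied to the negated values, which turns an upper
        bound into the lower bound 1.\<close>
      ultimately have "1 \<le> coord i x / ?t"
        using convex_bound_le[of "- (coord i u / ?t)" "-1" "- (coord i v / ?t)" "1 - r" r] by simp
      then show "fold_map ?t x = ?M x" by (rule fold_map_eq_mirror[OF t(1) 1 i])
    qed
    also have "\<dots> = closed_segment (?M u) (?M v)" by (rule mirror_closed_segment)
    also have "crease_at a m (\<not> up) \<dots> =
      Some (crease_of (a (Suc j)) (aligned ((-2) ^ Suc j) (?M p) = (\<not> up)))"
        using Suc.IH[OF mirror_lattice[OF i t(2) Suc.prems(1)] mirror_lattice[OF i t(2) Suc.prems(2)] _
         mirror_open_segment[OF Suc.prems(4) i] mirror_interior[OF t(1) int i pi]]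
         on_line_mirror[OF i _ r] \<open>j < m\<close> Suc.prems(3,6,7) by (simp add: dist_mirror[OF i] Suc_leI del: power_Suc)
    also have "aligned ((-2) ^ Suc j) (?M p) \<longleftrightarrow> \<not> aligned ((-2) ^ Suc j) p"
      using aligned_mirror[OF i _ r Suc.prems(7)] \<open>j < m\<close> by (simp add: Suc_leI del: power_Suc)
    finally show ?thesis by auto
  qed
qed

section \<open>Subdivided triangles\<close>

text \<open>Each side is shorter than the sum of the other two, so the corners are affinely
  independent. This recovers the corners from a triangle that is given only as a set.\<close>

lemma regular_corners_extreme_points:
  assumes "regular_corners s p q r"
  shows "{x. x extreme_point_of convex hull {p, q, r}} = {p, q, r}"
proof -
  have s: "s > 0" "dist p q = s" "dist q r = s" "dist r p = s"
    using assms by (auto simp: regular_corners_def)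
  then have ne: "p \<noteq> q" "q \<noteq> r" "p \<noteq> r" by auto
  have "\<not> collinear {p, q, r}"
    using s by (auto simp: collinear_between_cases between dist_commute)
  then have "\<not> affine_dependent {p, q, r}"
    using collinear_3_eq_affine_dependent ne by blast
  then show ?thesis by (auto simp: extreme_point_of_convex_hull_affine_independent)
qed

lemma regular_corners_unique:
  assumes "regular_corners s p q r" "regular_corners s' p' q' r'"
    "convex hull {p, q, r} = convex hull {p', q', r'}"
  shows "{p, q, r} = {p', q', r'}"
  by (rule trans[OF regular_corners_extreme_points[OF assms(1), unfolded assms(3), symmetric]
      regular_corners_extreme_points[OF assms(2)]])

lemma scaled_T0_hull:
  "scaled_T0 t = convex hull {t *\<^sub>R corner 1, t *\<^sub>R corner 2, t *\<^sub>R corner 3}"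
proof -
  have "T0 = convex hull {corner 1, corner 2, corner 3}"
    by (simp add: T0_def corner_def insert_commute)
  then show ?thesis
    using convex_hull_scaling[of t "{corner 1, corner 2, corner 3}"] unfolding scaled_T0_image by simp
qed

lemma dist_eqI_coord:
  assumes "(coord 1 p - coord 1 q)\<^sup>2 + (coord 2 p - coord 2 q)\<^sup>2 + (coord 3 p - coord 3 q)\<^sup>2 = 18 * t\<^sup>2" "t \<ge> 0"
  shows "dist p q = t"
proof -
  have "(dist p q)\<^sup>2 = t\<^sup>2" using dist_coord[of p q] assms(1) by simp
  then show ?thesis using assms(2) by simp
qed

lemma regular_corners_scaled:
  assumes "t > 0"
  shows "regular_corners t (t *\<^sub>R corner 1) (t *\<^sub>R corner 2) (t *\<^sub>R corner 3)"
  using assms unfolding regular_corners_def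
  by (intro conjI dist_eqI_coord) (simp_all add: corner_coord power2_eq_square algebra_simps)

lemma center_scaled_T0:
  assumes "t > 0"
  shows "center (scaled_T0 t) = 0"
proof -
  let ?c = "\<lambda>i. t *\<^sub>R corner i"
  have reg: "regular_corners t (?c 1) (?c 2) (?c 3)" using regular_corners_scaled[OF assms] .
  then have "?c 1 \<noteq> ?c 2" "?c 2 \<noteq> ?c 3" "?c 1 \<noteq> ?c 3" by (auto simp: regular_corners_def)
  then have "center (scaled_T0 t) = (?c 1 + ?c 2 + ?c 3) / 3"
    unfolding center_def scaled_T0_hull regular_corners_extreme_points[OF reg] by (simp add: add.assoc)
  also have "?c 1 + ?c 2 + ?c 3 = 0"
    by (rule coord_eqI) (auto simp: corner_coord)
  finally show ?thesis by simp
qed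

lemma positive_scaled_T0:
  assumes "t > 0"
  shows "positive_triangle (scaled_T0 t)"
  unfolding positive_triangle_def
proof (intro exI conjI)
  show "regular_corners t (t *\<^sub>R corner 2) (t *\<^sub>R corner 3) (t *\<^sub>R corner 1)"
    using regular_corners_scaled[OF assms] by (auto simp: regular_corners_def)
  show "scaled_T0 t = convex hull {t *\<^sub>R corner 2, t *\<^sub>R corner 3, t *\<^sub>R corner 1}"
    unfolding scaled_T0_hull by (simp add: insert_commute)
  show "Im (t *\<^sub>R corner 2) = Im (t *\<^sub>R corner 3)" "Im (t *\<^sub>R corner 1) > Im (t *\<^sub>R corner 2)"
    using assms by (auto simp: corner_def intro: order.strict_trans[of _ 0])
qed

lemma coord_of_nat_mult [simp]: "coord i (of_nat n * p) = real n * coord i p"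
  using coord_of_real_mult[of i "real n" p] by simp

lemma coord_divide_of_nat [simp]: "coord i (p / of_nat n) = coord i p / real n"
proof -
  have "p / of_nat n = of_real (1 / real n) * p" by (simp add: divide_inverse)
  then show ?thesis by (simp only: coord_of_real_mult) simp
qed

text \<open>The combination with weights \<open>i, j, l\<close> at the corners 1, 2, 3 has
  coordinates \<open>N - 3i\<close>, \<open>N - 3j\<close>, \<open>N - 3l\<close>: nonnegative
  integral weights amount to lattice levels not above \<open>N\<close>.\<close>

lemma subdivision_nodes_scaled_T0:
  assumes "N > 0"
  shows "subdivision_nodes (scaled_T0 (real N)) = lattice (real N) \<inter> scaled_T0 (real N)"
proof (intro equalityI subsetI)
  let ?c = "\<lambda>i. real N *\<^sub>R corner i"
  have N: "real N > 0" using assms by simp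
  note reg = regular_corners_scaled[OF N]
  fix v assume "v \<in> subdivision_nodes (scaled_T0 (real N))"
  then obtain p q r m i j l where m: "regular_corners (real m) p q r" "scaled_T0 (real N) = convex hull {p, q, r}"
    "i + j + l = m" "v = (of_nat i * p + of_nat j * q + of_nat l * r) / of_nat m"
    unfolding subdivision_nodes_def by blast
  have eq: "{p, q, r} = {?c 1, ?c 2, ?c 3}"
    using regular_corners_unique[OF m(1) reg] m(2) unfolding scaled_T0_hull by simp
  have "p \<in> {?c 1, ?c 2, ?c 3}" "q \<in> {?c 1, ?c 2, ?c 3}" unfolding eq[symmetric] by simp_all
  moreover have "p \<noteq> q" using m(1) by (auto simp: regular_corners_def)
  ultimately have "dist p q = real N"
    using reg unfolding regular_corners_def by (auto simp: dist_commute)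
  then have mN: "m = N" using m(1) by (simp add: regular_corners_def)
  \<comment> \<open>The corners \<open>p, q, r\<close> come in unknown order: the witness is 1 at
    the corner opposite side \<open>k\<close> and 0 at the two others.\<close>
  have d: "\<exists>d::int. d \<ge> 0 \<and> coord k x = real N - 3 * real N * of_int d" if "x \<in> {p, q, r}" "k \<in> {1,2,3}" for x k
  proof -
    have "coord k x = real N \<or> coord k x = - 2 * real N"
      using that unfolding eq by (auto simp: corner_coord)
    then show ?thesis by (auto intro: exI[of _ 0] exI[of _ 1])
  qed
  have "(coord k v - real N) / 3 \<in> \<int> \<and> coord k v / real N \<le> 1" if k: "k \<in> {1,2,3}" for k
  proof -
    obtain a b c :: int where abc: "a \<ge> 0" "b \<ge> 0" "c \<ge> 0"
      "coord k p = real N - 3 * real N * of_int a" "coord k q = real N - 3 * real N * of_int b"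
      "coord k r = real N - 3 * real N * of_int c"
      using d[OF _ k, of p] d[OF _ k, of q] d[OF _ k, of r] by auto
    have ij: "real N = real i + real j + real l" using m(3) mN by auto
    have "coord k v = (real i * coord k p + real j * coord k q + real l * coord k r) / real N"
      unfolding m(4) mN by simp
    also have "\<dots> = (real i + real j + real l) - 3 * (real i * of_int a + real j * of_int b + real l * of_int c)"
      unfolding abc using N by (simp add: field_simps)
    also have "\<dots> = real N - 3 * of_int (int i * a + int j * b + int l * c)"
      unfolding ij by simp
    finally have v: "coord k v = real N - 3 * of_int (int i * a + int j * b + int l * c)" .
    have "(coord k v - real N) / 3 = of_int (- (int i * a + int j * b + int l * c))"
      unfolding v by simp
    then have "(coord k v - real N) / 3 \<in> \<int>" by (metis Ints_of_int)
    moreover have "0 \<le> int i * a + int j * b + int l * c" using abc by simp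
    then have "0 \<le> real_of_int (int i * a + int j * b + int l * c)" by (simp only: of_int_0_le_iff)
    then have "coord k v \<le> real N" unfolding v by simp
    ultimately show ?thesis using N by simp
  qed
  then show "v \<in> lattice (real N) \<inter> scaled_T0 (real N)"
    unfolding lattice_def using N by (auto simp: scaled_T0_coord)
next
  let ?c = "\<lambda>i. real N *\<^sub>R corner i"
  have N: "real N > 0" using assms by simp
  note reg = regular_corners_scaled[OF N]
  fix v assume v: "v \<in> lattice (real N) \<inter> scaled_T0 (real N)"
  have "\<exists>n::nat. coord k v = real N - 3 * real n" if k: "k \<in> {1,2,3}" for k
  proof -
    have "(coord k v - real N) / 3 \<in> \<int>" using v k by (auto simp: lattice_def)
    then obtain z where "(coord k v - real N) / 3 = of_int z" by (auto elim: Ints_cases)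
    then have z: "coord k v = real N + 3 * of_int z" by (simp add: field_simps)
    have "coord k v / real N \<le> 1" using v k N by (auto simp: scaled_T0_coord)
    then have "z \<le> 0" using z N by simp
    then have "coord k v = real N - 3 * real (nat (- z))" using z by simp
    then show ?thesis ..
  qed
  from this[of 1] this[of 2] this[of 3] obtain i j l :: nat where c: "coord 1 v = real N - 3 * real i"
    "coord 2 v = real N - 3 * real j" "coord 3 v = real N - 3 * real l" by auto
  then have "real N = real (i + j + l)" using coord_sum[of v] by simp
  then have ijl: "i + j + l = N" by linarith
  have eq: "v = (of_nat i * ?c 1 + of_nat j * ?c 2 + of_nat l * ?c 3) / of_nat N"
  proof (rule coord_eqI)
    fix k :: nat assume "k \<in> {1,2,3}"
    moreover have "coord k ((of_nat i * ?c 1 + of_nat j * ?c 2 + of_nat l * ?c 3) / of_nat N)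
        = real i * coord k (corner 1) + real j * coord k (corner 2) + real l * coord k (corner 3)" for k
      using N by (simp add: add_divide_distrib)
    moreover have "real N = real i + real j + real l" using ijl by auto
    ultimately show "coord k v = coord k ((of_nat i * ?c 1 + of_nat j * ?c 2 + of_nat l * ?c 3) / of_nat N)"
      by (auto simp: c corner_coord)
  qed
  then show "v \<in> subdivision_nodes (scaled_T0 (real N))"
    unfolding subdivision_nodes_def using reg scaled_T0_hull ijl by blast
qed

section \<open>Edges recovered from a single point\<close>

text \<open>For a point in an open edge of the grid this is the edge; off the grid lines it is contained
  in the unit triangle around the point.\<close>

definition cell :: "real \<Rightarrow> complex \<Rightarrow> complex set" where
  "cell s p = {x. \<forall>i\<in>{1,2,3}. \<forall>b. (b - s) / 3 \<in> \<int> \<longrightarrow>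
    (coord i p \<le> b \<longrightarrow> coord i x \<le> b) \<and> (b \<le> coord i p \<longrightarrow> b \<le> coord i x)}"

lemma cellD:
  assumes "x \<in> cell s p" "i \<in> {1,2,3}" "(b - s) / 3 \<in> \<int>"
  shows "coord i p \<le> b \<Longrightarrow> coord i x \<le> b" "b \<le> coord i p \<Longrightarrow> b \<le> coord i x"
  using assms unfolding cell_def by blast+

text \<open>The coordinate that is constant on the edge is pinned by both inequalities at its level;
  a second one is confined between its values at the ends, and the third follows from the zero
  sum.\<close>

lemma closed_edge_eq_cell:
  assumes "u \<in> lattice s" "v \<in> lattice s" "dist u v = 1" "p \<in> open_segment u v"
  shows "closed_segment u v = cell s p"
proof (intro equalityI subsetI)
  fix x assume x: "x \<in> closed_segment u v"
  obtain r where r: "0 \<le> r" "r \<le> 1" "x = (1 - r) *\<^sub>R u + r *\<^sub>R v"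
    using x unfolding in_segment by blast
  show "x \<in> cell s p" unfolding cell_def
  proof (intro CollectI ballI allI impI)
    fix i :: nat and b assume i: "i \<in> {1,2,3}" and b: "(b - s) / 3 \<in> \<int>"
    have cx: "coord i x = (1 - r) * coord i u + r * coord i v" by (simp add: r)
    show "(coord i p \<le> b \<longrightarrow> coord i x \<le> b) \<and> (b \<le> coord i p \<longrightarrow> b \<le> coord i x)"
      unfolding open_edge_le_iff[OF assms i b] cx
      using r convex_bound_le[of "coord i u" b "coord i v" "1 - r" r]
        convex_bound_le[of "- coord i u" "- b" "- coord i v" "1 - r" r] by auto
  qed
next
  fix x assume x: "x \<in> cell s p"
  obtain i where i: "i \<in> {1,2,3}" "coord i u = coord i v" using edge_parallel_to_side[OF assms(1-3)] by blast
  obtain k l where kl: "{1,2,3} = {i,k,l}" "i \<noteq> k" "i \<noteq> l" "k \<noteq> l"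
    using index_completion[OF i(1)] by metis
  have k: "k \<in> {1,2,3}" unfolding kl(1) by simp
  have l: "coord l y = - coord i y - coord k y" for y
    using sum_indices[OF kl, of "\<lambda>j. coord j y"] coord_sum[of y] by simp
  have ne: "coord k u \<noteq> coord k v"
  proof
    assume "coord k u = coord k v"
    then have "u = v" by (intro coord_eqI) (unfold kl(1), auto simp: l i)
    then show False using assms(3) by simp
  qed
  have xi: "coord i x = coord i u"
    using cellD[OF x i(1) latticeD[OF assms(1) i(1)]] open_edge_le_iff[OF assms i(1) latticeD[OF assms(1) i(1)]] i
    by auto
  \<comment> \<open>The parameter on the segment, read off from a coordinate that varies along the
    edge.\<close>
  define r where "r = (coord k x - coord k u) / (coord k v - coord k u)"
  have xk: "coord k x = coord k u + r * (coord k v - coord k u)" using ne by (simp add: r_def)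
  have bd: "coord k x \<le> max (coord k u) (coord k v)" "min (coord k u) (coord k v) \<le> coord k x"
    using cellD[OF x k latticeD[OF assms(1) k]] cellD[OF x k latticeD[OF assms(2) k]]
      open_edge_coord_cases[OF assms k] by (auto simp: max_def min_def)
  have r: "0 \<le> r" "r \<le> 1"
    using bd open_edge_coord_cases[OF assms k] ne unfolding r_def by (auto simp: max_def min_def field_simps split: if_splits)
  have "x = (1 - r) *\<^sub>R u + r *\<^sub>R v"
  proof (rule coord_eqI)
    fix j :: nat assume "j \<in> {1,2,3}"
    then have "j = i \<or> j = k \<or> j = l" unfolding kl(1) by simp
    then show "coord j x = coord j ((1 - r) *\<^sub>R u + r *\<^sub>R v)"
      by (auto simp: l xi xk i algebra_simps)
  qed
  then show "x \<in> closed_segment u v" unfolding in_segment using r by blast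
qed

text \<open>Doubling a coarse level gives a fine level, so the conditions defining the fine cell
  include those of the doubled coarse one.\<close>

lemma fine_edge_subset_cell:
  assumes "u \<in> lattice (2 * s)" "v \<in> lattice (2 * s)" "dist u v = 1" "p \<in> open_segment u v"
  shows "closed_segment u v \<subseteq> (*\<^sub>R) 2 ` cell s (p /\<^sub>R 2)"
proof
  fix x assume "x \<in> closed_segment u v"
  then have x: "x \<in> cell (2 * s) p" using closed_edge_eq_cell[OF assms] by simp
  have "x /\<^sub>R 2 \<in> cell s (p /\<^sub>R 2)" unfolding cell_def
  proof (intro CollectI ballI allI impI)
    fix i :: nat and b assume i: "i \<in> {1,2,3}" and b: "(b - s) / 3 \<in> \<int>"
    have "(2 * b - 2 * s) / 3 = 2 * ((b - s) / 3)" by simp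
    also have "\<dots> \<in> \<int>" using b by (intro Ints_mult) auto
    finally have "(2 * b - 2 * s) / 3 \<in> \<int>" .
    from cellD[OF x i this]
    show "(coord i (p /\<^sub>R 2) \<le> b \<longrightarrow> coord i (x /\<^sub>R 2) \<le> b) \<and> (b \<le> coord i (p /\<^sub>R 2) \<longrightarrow> b \<le> coord i (x /\<^sub>R 2))"
      by auto
  qed
  then show "x \<in> (*\<^sub>R) 2 ` cell s (p /\<^sub>R 2)" by (intro image_eqI[of _ _ "x /\<^sub>R 2"]) auto
qed

lemma lattice_bracket:
  assumes "(x - s) / 3 \<notin> \<int>"
  obtains b where "(b - s) / 3 \<in> \<int>" "b < x" "x < b + (3::real)"
proof -
  define b where "b = 3 * of_int \<lfloor>(x - s) / 3\<rfloor> + s"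
  have "(b - s) / 3 = of_int \<lfloor>(x - s) / 3\<rfloor>" by (simp add: b_def)
  then have "(b - s) / 3 \<in> \<int>" by simp
  moreover have "of_int \<lfloor>(x - s) / 3\<rfloor> \<noteq> (x - s) / 3" using assms by (metis Ints_of_int)
  then have "of_int \<lfloor>(x - s) / 3\<rfloor> < (x - s) / 3" using of_int_floor_le less_le by blast
  then have "b < x" unfolding b_def by (simp add: field_simps)
  moreover have "x < b + 3" unfolding b_def using real_of_int_floor_add_one_gt[of "(x - s) / 3"] by (simp add: field_simps)
  ultimately show ?thesis using that by blast
qed

lemma coord_exists_indices:
  assumes kl: "{1,2,3} = {i,k,l}" "i \<noteq> k" "i \<noteq> l" "k \<noteq> l" and "x + y + z = 0"
  obtains p where "coord i p = x" "coord k p = y" "coord l p = z"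
proof -
  define f where "f j = (if j = i then x else if j = k then y else z)" for j
  have "f 1 + f 2 + f 3 = 0" using sum_indices[OF kl, of f] assms by (simp add: f_def)
  then obtain p where "coord 1 p = f 1" "coord 2 p = f 2" "coord 3 p = f 3" using coord_exists by blast
  then have "coord j p = f j" if "j \<in> {1,2,3}" for j using that by auto
  then have "coord j p = f j" if "j \<in> {i,k,l}" for j using that unfolding kl(1) by blast
  then show ?thesis using that[of p] kl by (simp add: f_def)
qed

text \<open>As \<open>p\<close> is not a node, coordinate \<open>k\<close> lies strictly between
  adjacent levels, which cut the edge around \<open>p\<close> out of the line.\<close>

lemma edge_through_point:
  assumes s: "s \<in> \<int>" "s > 0" and p: "p \<in> scaled_T0 s" "p \<notin> lattice s"
    and i: "i \<in> {1,2,3}" "(coord i p - s) / 3 \<in> \<int>"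
  obtains u v w where "u \<in> lattice s \<inter> scaled_T0 s" "v \<in> lattice s \<inter> scaled_T0 s" "w \<in> lattice s \<inter> scaled_T0 s"
    "regular_corners 1 u v w" "p \<in> open_segment u v"
proof -
  obtain k l where kl: "{1,2,3} = {i,k,l}" "i \<noteq> k" "i \<noteq> l" "k \<noteq> l"
    using index_completion[OF i(1)] by metis
  have k: "k \<in> {1,2,3}" "l \<in> {1,2,3}" unfolding kl(1) by simp_all
  have sum: "coord i y + coord k y + coord l y = 0" for y
    using sum_indices[OF kl, of "\<lambda>j. coord j y"] coord_sum[of y] by simp
  have "(coord k p - s) / 3 \<notin> \<int>" using lattice_two_coords[OF s(1) i(1) k(1) kl(2) i(2)] p(2) by blast
  then obtain b where b: "(b - s) / 3 \<in> \<int>" "b < coord k p" "coord k p < b + 3"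
    by (rule lattice_bracket)
  define c where "c = coord i p"
  obtain u where u: "coord i u = c" "coord k u = b" "coord l u = - c - b"
    using coord_exists_indices[OF kl, of c b "- c - b"] by auto
  obtain v where v: "coord i v = c" "coord k v = b + 3" "coord l v = - c - b - 3"
    using coord_exists_indices[OF kl, of c "b + 3" "- c - b - 3"] by auto
  \<comment> \<open>The third vertex lies towards smaller coordinate \<open>i\<close>; its other
    coordinates are the larger ones of \<open>u\<close> and \<open>v\<close>, so the unit triangle
    cannot leave \<open>s T0\<close>.\<close>
  obtain w where w: "coord i w = c - 3" "coord k w = b + 3" "coord l w = - c - b"
    using coord_exists_indices[OF kl, of "c - 3" "b + 3" "- c - b"] by auto
  have ci: "(c - s) / 3 \<in> \<int>" using i by (simp add: c_def)
  have b3: "(b + 3 - s) / 3 \<in> \<int>" "(c - 3 - s) / 3 \<in> \<int>"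
    using Ints_add[OF b(1) Ints_1] Ints_diff[OF ci Ints_1] by (simp_all add: field_simps)
  have lat: "u \<in> lattice s" "v \<in> lattice s" "w \<in> lattice s"
    using lattice_two_coords[OF s(1) i(1) k(1) kl(2)] u v w b b3 ci by auto
  have le: "coord j p \<le> s" if "j \<in> {1,2,3}" for j
    using p(1) s that by (auto simp: scaled_T0_coord)
  \<comment> \<open>As \<open>s\<close> is itself a level, rounding up a coordinate of
    \<open>p\<close> cannot pass it.\<close>
  have step: "x \<le> s" if "(x - s) / 3 \<in> \<int>" "x < s + 3" for x
    using lattice_step[of x s s] that by simp
  have "c \<le> s" using le[OF i(1)] by (simp add: c_def)
  moreover have "b + 3 \<le> s" using step[OF b3(1)] le[OF k(1)] b by simp
  moreover have "- c - b \<le> s"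
    using step[of "coord l u"] latticeD[OF lat(1) k(2)] le[OF k(2)] sum[of p] b u by (simp add: c_def)
  ultimately have "coord j u \<le> s" "coord j v \<le> s" "coord j w \<le> s" if "j \<in> {1,2,3}" for j
    using that unfolding kl(1) by (auto simp: u v w)
  then have T: "u \<in> scaled_T0 s" "v \<in> scaled_T0 s" "w \<in> scaled_T0 s"
    using s by (simp_all add: scaled_T0_coord)
  have d: "dist x y = 1" if "(coord i x - coord i y)\<^sup>2 + (coord k x - coord k y)\<^sup>2 + (coord l x - coord l y)\<^sup>2 = 18" for x y
    unfolding dist_1_coord using that sum_indices[OF kl, of "\<lambda>j. (coord j x - coord j y)\<^sup>2"] by simp
  have reg: "regular_corners 1 u v w"
    unfolding regular_corners_def by (auto intro!: d simp: u v w)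
  define r where "r = (coord k p - b) / 3"
  have "p = (1 - r) *\<^sub>R u + r *\<^sub>R v"
  proof (rule coord_eqI)
    fix j :: nat assume "j \<in> {1,2,3}"
    then have "j = i \<or> j = k \<or> j = l" unfolding kl(1) by simp
    moreover have "coord k p = b + 3 * r" by (simp add: r_def field_simps)
    moreover have "coord l p = - c - (b + 3 * r)" using sum[of p] by (simp add: c_def r_def field_simps)
    ultimately show "coord j p = coord j ((1 - r) *\<^sub>R u + r *\<^sub>R v)"
      by (auto simp: u v c_def[symmetric] algebra_simps)
  qed
  moreover have "0 < r" "r < 1" using b by (auto simp: r_def)
  moreover have "u \<noteq> v" using u v by auto
  ultimately have "p \<in> open_segment u v" unfolding in_segment by blast
  then show ?thesis using that[of u v w] lat T reg by blast
qed

section \<open>One substitution step\<close>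

text \<open>Differences of at most 3 and vanishing coordinate sums leave one position for
  \<open>R\<close>. The bounds of the three half-planes then add up to 3, the mark of a positive
  unit triangle.\<close>

lemma lattice_regular_triangle_normal_form:
  assumes "P \<in> lattice s" "Q \<in> lattice s" "R \<in> lattice s" "regular_corners 1 P Q R"
    and "coord 1 P = coord 1 Q" "coord 1 R < coord 1 P" "coord 2 P < coord 2 Q"
  shows "convex hull {R, P, Q} = {p. coord 1 p \<le> coord 1 P \<and> coord 2 p \<le> coord 2 Q \<and> coord 3 p \<le> coord 3 P}"
    and "coord 1 P + coord 2 Q + coord 3 P = 3"
proof -
  have d: "dist P Q = 1" "dist Q R = 1" "dist R P = 1" using assms(4) by (auto simp: regular_corners_def)
  note ed = lattice_edge_coord[OF assms(1,2) d(1)] lattice_edge_coord[OF assms(2,3) d(2)]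
    lattice_edge_coord[OF assms(3,1) d(3)]
  note sums = coord_sum[of P] coord_sum[of Q] coord_sum[of R]
  have Q2: "coord 2 Q = coord 2 P + 3" using ed(1)[of 2] assms(7) by auto
  have Q3: "coord 3 Q = coord 3 P - 3" using sums assms(5) Q2 by simp
  have R1: "coord 1 R = coord 1 P - 3" using ed(3)[of 1] assms(6) by auto
  have "coord 2 R \<le> coord 2 P + 3" using ed(3)[of 2] by auto
  moreover have "coord 3 R \<le> coord 3 Q + 3" using ed(2)[of 3] by auto
  then have "coord 3 R \<le> coord 3 P" using Q3 by simp
  moreover have "coord 2 R + coord 3 R = coord 2 P + coord 3 P + 3" using sums R1 by simp
  ultimately have R: "coord 2 R = coord 2 P + 3" "coord 3 R = coord 3 P" by linarith+
  show "convex hull {R, P, Q} = {p. coord 1 p \<le> coord 1 P \<and> coord 2 p \<le> coord 2 Q \<and> coord 3 p \<le> coord 3 P}"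
    by (rule cell_hull) (simp_all add: Q2 Q3 R1 R assms(5))
  show "coord 1 P + coord 2 Q + coord 3 P = 3" using sums Q2 by simp
qed

text \<open>The first level at or above the coordinate. For integral \<open>s\<close> and
  \<open>p\<close> off the lines, the three values add up to 3 in positive unit triangles and to 6
  in negative ones.\<close>

definition upper :: "real \<Rightarrow> nat \<Rightarrow> complex \<Rightarrow> real" where
  "upper s i p = 3 * of_int \<lceil>(coord i p - s) / 3\<rceil> + s"

lemma upper_lattice: "(upper s i p - s) / 3 \<in> \<int>"
  by (simp add: upper_def)

lemma upper_bounds: "coord i p \<le> upper s i p" "upper s i p < coord i p + 3"
proof -
  have "(coord i p - s) / 3 \<le> of_int \<lceil>(coord i p - s) / 3\<rceil>" by (rule le_of_int_ceiling)
  then show "coord i p \<le> upper s i p" unfolding upper_def by (simp only: field_simps)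
  have "of_int \<lceil>(coord i p - s) / 3\<rceil> - 1 < (coord i p - s) / 3" using ceiling_correct by blast
  then show "upper s i p < coord i p + 3" unfolding upper_def by (simp add: field_simps)
qed

lemma upper_unique:
  assumes "(x - s) / 3 \<in> \<int>" "coord i p \<le> x" "x < coord i p + 3"
  shows "upper s i p = x"
  using lattice_step[of x s "upper s i p"] lattice_step[of "upper s i p" s x] assms upper_lattice[of s i p]
    upper_bounds(1)[of i p s] upper_bounds(2)[of s i p] by simp

lemma coord_1_Im: "coord 1 p = coord 1 q \<longleftrightarrow> Im p = Im q" "coord 1 p < coord 1 q \<longleftrightarrow> Im q < Im p"
  unfolding coord_explicit by simp_all

text \<open>A positive unit triangle is the intersection of the half-planes below three levels with
  sum 3, and around \<open>p\<close> these can only be the next levels above. The set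
  \<open>A\<close> is meant for a halved fine edge, which lies in the cell of
  \<open>p\<close>.\<close>

lemma positive_unit_triangle_iff:
  assumes s: "s \<in> \<int>" "s > 0" and p: "p \<in> scaled_T0 s"
    and off: "\<And>i. i \<in> {1,2,3} \<Longrightarrow> (coord i p - s) / 3 \<notin> \<int>"
    and A: "p \<in> A" "A \<subseteq> cell s p"
  shows "(\<exists>\<tau>\<in>unit_triangles (lattice s \<inter> scaled_T0 s). positive_triangle \<tau> \<and> A \<subseteq> \<tau>)
    \<longleftrightarrow> upper s 1 p + upper s 2 p + upper s 3 p = 3"
proof
  let ?h = "\<lambda>i. upper s i p"
  assume h3: "?h 1 + ?h 2 + ?h 3 = 3"
  obtain u where u: "coord 1 u = ?h 1 - 3" "coord 2 u = ?h 2" "coord 3 u = ?h 3"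
    using coord_exists[of "?h 1 - 3" "?h 2" "?h 3"] h3 by auto
  obtain v where v: "coord 1 v = ?h 1" "coord 2 v = ?h 2 - 3" "coord 3 v = ?h 3"
    using coord_exists[of "?h 1" "?h 2 - 3" "?h 3"] h3 by auto
  obtain w where w: "coord 1 w = ?h 1" "coord 2 w = ?h 2" "coord 3 w = ?h 3 - 3"
    using coord_exists[of "?h 1" "?h 2" "?h 3 - 3"] h3 by auto
  have reg: "regular_corners 1 u v w" unfolding regular_corners_def dist_1_coord by (simp add: u v w)
  have lat: "u \<in> lattice s" "v \<in> lattice s" "w \<in> lattice s"
    using lattice_two_coords[OF s(1), of 2 3 u] lattice_two_coords[OF s(1), of 1 3 v]
      lattice_two_coords[OF s(1), of 1 2 w] upper_lattice by (simp_all add: u v w)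
  have "?h i \<le> s" if "i \<in> {1,2,3}" for i
  proof (rule lattice_step[OF upper_lattice])
    have "coord i p \<le> s" using p s that by (auto simp: scaled_T0_coord)
    then show "?h i < s + 3" using upper_bounds(2)[of s i p] by simp
  qed simp
  from this[of 1] this[of 2] this[of 3] have T: "u \<in> scaled_T0 s" "v \<in> scaled_T0 s" "w \<in> scaled_T0 s"
    using s by (simp_all add: scaled_T0_coord u v w)
  have "convex hull {u, v, w} \<in> unit_triangles (lattice s \<inter> scaled_T0 s)"
    unfolding unit_triangles_def using reg lat T by blast
  moreover have "positive_triangle (convex hull {u, v, w})"
    unfolding positive_triangle_def
  proof (intro exI conjI)
    show "regular_corners 1 v w u" using reg by (simp add: regular_corners_def)
    show "convex hull {u, v, w} = convex hull {v, w, u}" by (simp add: insert_commute)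
    show "Im v = Im w" "Im u > Im v" unfolding coord_1_Im[symmetric] by (simp_all add: u v w)
  qed
  moreover have "A \<subseteq> convex hull {u, v, w}"
    unfolding cell_hull[OF u v w] using A(2) cellD(1)[OF _ _ upper_lattice upper_bounds(1)] by blast
  ultimately show "\<exists>\<tau>\<in>unit_triangles (lattice s \<inter> scaled_T0 s). positive_triangle \<tau> \<and> A \<subseteq> \<tau>" by blast
next
  assume "\<exists>\<tau>\<in>unit_triangles (lattice s \<inter> scaled_T0 s). positive_triangle \<tau> \<and> A \<subseteq> \<tau>"
  then obtain u v w where lat: "u \<in> lattice s" "v \<in> lattice s" "w \<in> lattice s" and reg: "regular_corners 1 u v w"
    and pos: "positive_triangle (convex hull {u, v, w})" and sub: "A \<subseteq> convex hull {u, v, w}"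
    unfolding unit_triangles_def by blast
  obtain s' P Q R where PQR: "regular_corners s' P Q R" "convex hull {u, v, w} = convex hull {P, Q, R}"
    "Im P = Im Q" "Im R > Im P" using pos unfolding positive_triangle_def by blast
  have eq: "{u, v, w} = {P, Q, R}" by (rule regular_corners_unique[OF reg PQR(1,2)])
  have in3: "P \<in> {u, v, w}" "Q \<in> {u, v, w}" "R \<in> {u, v, w}" unfolding eq by simp_all
  have "s' > 0" "dist P Q = s'" "dist Q R = s'" "dist R P = s'"
    using PQR(1) by (simp_all add: regular_corners_def)
  then have ne: "P \<noteq> Q" "Q \<noteq> R" "R \<noteq> P" by auto
  have "dist x y = 1" if "x \<in> {u, v, w}" "y \<in> {u, v, w}" "x \<noteq> y" for x y
    using that reg by (auto simp: regular_corners_def dist_commute)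
  then have reg1: "regular_corners 1 P Q R" using ne in3 by (simp add: regular_corners_def)
  have lat1: "P \<in> lattice s" "Q \<in> lattice s" "R \<in> lattice s" using in3 lat by auto
  have c1: "coord 1 P = coord 1 Q" "coord 1 R < coord 1 P" unfolding coord_1_Im using PQR by simp_all
  have "coord 2 P \<noteq> coord 2 Q"
  proof
    assume "coord 2 P = coord 2 Q"
    then have "P = Q" using c1 coord_sum[of P] coord_sum[of Q] by (intro coord_eqI) auto
    then show False using ne by simp
  qed
  \<comment> \<open>The ends of the horizontal side are ordered from left to right to reach the
    normal form.\<close>
  then obtain P' Q' where P': "P' \<in> lattice s" "Q' \<in> lattice s" "regular_corners 1 P' Q' R" "{u, v, w} = {R, P', Q'}"
    "coord 1 P' = coord 1 Q'" "coord 1 R < coord 1 P'" "coord 2 P' < coord 2 Q'"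
  proof (cases "coord 2 P < coord 2 Q")
    case True
    then show ?thesis using that[of P Q] lat1 c1 eq reg1 by (auto simp: regular_corners_def)
  next
    case False
    then have "coord 2 Q < coord 2 P" using \<open>coord 2 P \<noteq> coord 2 Q\<close> by simp
    then show ?thesis using that[of Q P] lat1 c1 eq reg1 by (auto simp: regular_corners_def dist_commute)
  qed
  note nf = lattice_regular_triangle_normal_form[OF P'(1,2) lat1(3) P'(3,5-7)]
  have "p \<in> convex hull {R, P', Q'}" using A(1) sub P'(4) by auto
  then have le: "coord 1 p \<le> coord 1 P'" "coord 2 p \<le> coord 2 Q'" "coord 3 p \<le> coord 3 P'"
    unfolding nf(1) by auto
  \<comment> \<open>For use with the three bounds of the triangle: their excesses over the
    coordinates of \<open>p\<close> are nonnegative and add up to 3, so each is at most 3, and the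
    value 3 is excluded because \<open>p\<close> is off the lines.\<close>
  have up: "upper s i p = x" if "i \<in> {1,2,3}" "(x - s) / 3 \<in> \<int>" "coord i p \<le> x" "x \<le> coord i p + 3" for i x
  proof (rule upper_unique[OF that(2,3)])
    have "x \<noteq> coord i p + 3"
    proof
      assume "x = coord i p + 3"
      then have "(coord i p - s) / 3 = (x - s) / 3 - 1" by (simp add: field_simps)
      then show False using off[OF that(1)] that(2) by (metis Ints_1 Ints_diff)
    qed
    then show "x < coord i p + 3" using that(4) by simp
  qed
  have "upper s 1 p = coord 1 P'" "upper s 2 p = coord 2 Q'" "upper s 3 p = coord 3 P'"
    using le nf(2) coord_sum[of p] latticeD[OF P'(1)] latticeD[OF P'(2)] by (auto intro!: up)
  then show "upper s 1 p + upper s 2 p + upper s 3 p = 3" using nf(2) by simp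
qed

section \<open>The grids of \<open>2^m T0\<close> and \<open>L\<close> compared\<close>

lemma power_minus_1_2: "(-1) ^ m * 2 ^ m = ((-2) ^ m :: real)"
  by (simp flip: power_mult_distrib)

lemma minus_1_power_mult: "(-1) ^ m * x = (if even m then x else - x :: real)"
  by simp

text \<open>The factor \<open>(-1)^m\<close>, a half-turn for odd \<open>m\<close>, moves the level
  \<open>2^m\<close> to \<open>(-2)^m\<close>, which is congruent to 1 modulo 3 and hence a level of
  \<open>L\<close>.\<close>

lemma line_index_signed:
  "line_index 1 i ((-1) ^ m *\<^sub>R p) = (-1) ^ m * ((coord i p - 2 ^ m) / 3) + ((-2) ^ m - 1) / 3"
  unfolding line_index_def by (simp add: power_minus_1_2[symmetric] algebra_simps flip: add_divide_distrib diff_divide_distrib)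

lemma line_index_signed_Ints:
  "line_index 1 i ((-1) ^ m *\<^sub>R p) \<in> \<int> \<longleftrightarrow> (coord i p - 2 ^ m) / 3 \<in> \<int>"
proof -
  have r: "((-2) ^ m - 1) / 3 \<in> (\<int> :: real set)" by (rule Ints_power_minus_2)
  then have "line_index 1 i ((-1) ^ m *\<^sub>R p) \<in> \<int> \<longleftrightarrow> (-1) ^ m * ((coord i p - 2 ^ m) / 3) \<in> \<int>"
    unfolding line_index_signed by (metis Ints_add Ints_diff add_diff_cancel)
  also have "\<dots> \<longleftrightarrow> (coord i p - 2 ^ m) / 3 \<in> \<int>"
    unfolding minus_1_power_mult by (cases "even m") (simp_all only: if_True if_False minus_in_Ints_iff)
  finally show ?thesis .
qed

text \<open>A half-turn exchanges positive and negative unit triangles, which accounts for the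
  parity of \<open>m\<close>.\<close>

lemma aligned_signed:
  assumes off: "\<not> on_line 1 ((-1) ^ m *\<^sub>R p)"
  shows "upper (2 ^ m) 1 p + upper (2 ^ m) 2 p + upper (2 ^ m) 3 p = 3
    \<longleftrightarrow> (aligned 1 ((-1) ^ m *\<^sub>R p) \<longleftrightarrow> even m)"
proof -
  let ?q = "(-1) ^ m *\<^sub>R p"
  define n where "n i = real_of_int \<lceil>(coord i p - 2 ^ m) / 3\<rceil>" for i
  define r :: real where "r = ((-2) ^ m - 1) / 3"
  have r: "r \<in> \<int>" unfolding r_def by (rule Ints_power_minus_2)
  have al: "aligned 1 ?q \<longleftrightarrow> real_of_int \<lceil>line_index 1 1 ?q\<rceil> + real_of_int \<lceil>line_index 1 2 ?q\<rceil> + real_of_int \<lceil>line_index 1 3 ?q\<rceil> = 0"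
    unfolding aligned_def by linarith
  have ca: "real_of_int \<lceil>line_index 1 1 ?q\<rceil> + real_of_int \<lceil>line_index 1 2 ?q\<rceil> + real_of_int \<lceil>line_index 1 3 ?q\<rceil> \<in> {0, 1}"
    using aligned_cases[OF _ off] by simp linarith
  have up: "upper (2 ^ m) i p = 3 * n i + 2 ^ m" for i by (simp add: upper_def n_def)
  show ?thesis
  proof (cases "even m")
    case True
    obtain z where z: "r = of_int z" using r by (auto elim: Ints_cases)
    have "real_of_int \<lceil>line_index 1 i ?q\<rceil> = n i + r" for i
      unfolding line_index_signed r_def[symmetric] n_def z using True by simp
    moreover have "3 * r = 2 ^ m - 1" using True by (simp add: r_def)
    ultimately show ?thesis using True unfolding al up by auto
  next
    case False
    have "real_of_int \<lceil>line_index 1 i ?q\<rceil> = r - n i + 1" if "i \<in> {1,2,3}" for i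
    proof -
      have "line_index 1 i ?q = r - (coord i p - 2 ^ m) / 3"
        unfolding line_index_signed r_def[symmetric] minus_1_power_mult using False by (simp only: if_False)
      moreover have "(coord i p - 2 ^ m) / 3 \<notin> \<int>"
        using off that line_index_signed_Ints unfolding on_line_def by blast
      ultimately show ?thesis unfolding n_def using ceiling_Ints_diff[OF r] by simp
    qed
    \<comment> \<open>Here the upper levels add up to 3 exactly when the ceilings add up to 1, which
      by \<open>ca\<close> is the alternative to alignment.\<close>
    moreover have "3 * r = - (2 ^ m) - 1" using False by (simp add: r_def)
    ultimately show ?thesis using False ca unfolding al up by auto
  qed
qed

section \<open>Coarse and fine unit edges\<close>

definition nodes :: "nat \<Rightarrow> complex set" where
  "nodes m = lattice (2 ^ m) \<inter> scaled_T0 (2 ^ m)"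

lemma subdivision_nodes_power: "subdivision_nodes (scaled_T0 (2 ^ m)) = nodes m"
  using subdivision_nodes_scaled_T0[of "2 ^ m"] by (simp add: nodes_def)

lemma unit_edges_nodesE:
  assumes "e \<in> unit_edges (nodes m)"
  obtains u v p where "e = closed_segment u v" "u \<in> nodes m" "v \<in> nodes m" "dist u v = 1" "p \<in> open_segment u v"
proof -
  obtain u v w where "e = closed_segment u v" "u \<in> nodes m" "v \<in> nodes m" "dist u v = 1"
    using assms unfolding unit_edges_def regular_corners_def by blast
  moreover then have "midpoint u v \<in> open_segment u v" by auto
  ultimately show ?thesis using that by blast
qed

lemma cell_unit_edge:
  assumes "p \<in> scaled_T0 (2 ^ m)" "p \<notin> lattice (2 ^ m)" "on_line 1 ((-1) ^ m *\<^sub>R p)"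
  obtains u v where "cell (2 ^ m) p = closed_segment u v" "u \<in> nodes m" "v \<in> nodes m" "dist u v = 1" "p \<in> open_segment u v"
    "cell (2 ^ m) p \<in> unit_edges (nodes m)"
proof -
  obtain i where i: "i \<in> {1,2,3}" "(coord i p - 2 ^ m) / 3 \<in> \<int>"
    using assms(3) line_index_signed_Ints unfolding on_line_def by blast
  obtain u v w where uvw: "u \<in> nodes m" "v \<in> nodes m" "w \<in> nodes m" "regular_corners 1 u v w" "p \<in> open_segment u v"
    using edge_through_point[OF _ _ assms(1,2) i] unfolding nodes_def by auto
  then have "dist u v = 1" by (simp add: regular_corners_def)
  then have "closed_segment u v = cell (2 ^ m) p"
    using closed_edge_eq_cell uvw by (simp add: nodes_def)
  moreover have "closed_segment u v \<in> unit_edges (nodes m)" unfolding unit_edges_def using uvw by blast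
  ultimately show ?thesis using that uvw \<open>dist u v = 1\<close> by metis
qed

text \<open>The half of \<open>p\<close> is no coarse node, so it lies in an open coarse edge or off
  the coarse lines. In the first case its cell is the only coarse edge whose double contains the
  fine edge, so the description in \<open>substitution\<close> picks it; in the second there is
  none.\<close>

lemma coarse_edge:
  assumes "u \<in> nodes (Suc m)" "v \<in> nodes (Suc m)" "dist u v = 1" "p \<in> open_segment u v"
  shows "on_line 1 ((-1) ^ m *\<^sub>R (p /\<^sub>R 2)) \<Longrightarrow> cell (2 ^ m) (p /\<^sub>R 2) \<in> unit_edges (nodes m)"
    and "closed_segment u v \<subseteq> (*\<^sub>R) 2 ` cell (2 ^ m) (p /\<^sub>R 2)"
    and "e \<in> unit_edges (nodes m) \<Longrightarrow> closed_segment u v \<subseteq> (*\<^sub>R) 2 ` e \<Longrightarrow>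
      e = cell (2 ^ m) (p /\<^sub>R 2) \<and> on_line 1 ((-1) ^ m *\<^sub>R (p /\<^sub>R 2))"
    and "p /\<^sub>R 2 \<in> scaled_T0 (2 ^ m)" "p /\<^sub>R 2 \<notin> lattice (2 ^ m)"
proof -
  let ?p = "p /\<^sub>R 2"
  have lat: "u \<in> lattice (2 * 2 ^ m)" "v \<in> lattice (2 * 2 ^ m)" using assms by (simp_all add: nodes_def)
  have cl: "p \<in> closed_segment u v" using assms(4) open_closed_segment by blast
  show T: "?p \<in> scaled_T0 (2 ^ m)"
  proof -
    have "convex (scaled_T0 (2 ^ Suc m))"
      unfolding scaled_T0_image T0_def by (intro convex_scaling convex_convex_hull)
    then have "p \<in> scaled_T0 (2 ^ Suc m)"
      using assms(1,2) cl unfolding nodes_def by (metis IntD2 closed_segment_subset subsetD)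
    then show ?thesis by (auto simp: scaled_T0_coord field_simps)
  qed
  \<comment> \<open>The double of a coarse node is a fine node, and an open fine edge contains
    none.\<close>
  have double: "2 *\<^sub>R x \<in> lattice (2 * 2 ^ m)" if x: "x \<in> lattice (2 ^ m)" for x
    unfolding lattice_def
  proof (intro CollectI ballI)
    fix i :: nat assume "i \<in> {1,2,3}"
    from latticeD[OF x this] have "2 * ((coord i x - 2 ^ m) / 3) \<in> \<int>" by (intro Ints_mult) auto
    then show "(coord i (2 *\<^sub>R x) - 2 * 2 ^ m) / 3 \<in> \<int>" by (simp add: algebra_simps)
  qed
  show nl: "?p \<notin> lattice (2 ^ m)"
    using double[of ?p] open_edge_not_lattice[OF lat assms(3,4)] by auto
  show "cell (2 ^ m) ?p \<in> unit_edges (nodes m)" if "on_line 1 ((-1) ^ m *\<^sub>R ?p)"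
    using cell_unit_edge[OF T nl that] by metis
  show "closed_segment u v \<subseteq> (*\<^sub>R) 2 ` cell (2 ^ m) ?p"
    by (rule fine_edge_subset_cell[OF lat assms(3,4)])
  show "e = cell (2 ^ m) ?p \<and> on_line 1 ((-1) ^ m *\<^sub>R ?p)"
    if e: "e \<in> unit_edges (nodes m)" and sub: "closed_segment u v \<subseteq> (*\<^sub>R) 2 ` e"
  proof -
    obtain x y z where xy: "e = closed_segment x y" "x \<in> nodes m" "y \<in> nodes m" "dist x y = 1"
      using unit_edges_nodesE[OF e] by metis
    have L: "x \<in> lattice (2 ^ m)" "y \<in> lattice (2 ^ m)" using xy by (simp_all add: nodes_def)
    have "p \<in> (*\<^sub>R) 2 ` e" using sub cl by blast
    then have "?p \<in> closed_segment x y" using xy by auto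
    then have o: "?p \<in> open_segment x y" using nl L unfolding open_segment_def by blast
    obtain i where i: "i \<in> {1,2,3}" "coord i x = coord i y" using edge_parallel_to_side[OF L xy(4)] by blast
    have "coord i ?p = coord i x" using open_edge_coord_cases[OF L xy(4) o i(1)] i(2) by auto
    then have "(coord i ?p - 2 ^ m) / 3 \<in> \<int>" using latticeD[OF L(1) i(1)] by (simp del: coord_scaleR)
    then have "on_line 1 ((-1) ^ m *\<^sub>R ?p)" unfolding on_line_def line_index_signed_Ints using i(1) by blast
    then show ?thesis using closed_edge_eq_cell[OF L xy(4) o] xy(1) by simp
  qed
qed

section \<open>The invariant of the substitutions\<close>

text \<open>The powers of \<open>-1\<close> and of \<^const>\<open>opposite\<close> undo the rotation and the exchange of colours,
  one for each substitution performed. The value is only constrained off the boundary, where the seed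
  has no influence.\<close>

definition folded_colouring :: "(nat \<Rightarrow> folding) \<Rightarrow> nat \<Rightarrow> coloured_triangle \<Rightarrow> bool" where
  "folded_colouring a m X \<longleftrightarrow> fst X = scaled_T0 (2 ^ m) \<and> dom (snd X) = unit_edges (nodes m) \<and>
    (\<forall>p j. p \<in> interior (scaled_T0 (2 ^ m)) \<longrightarrow> p \<notin> lattice (2 ^ m) \<longrightarrow>
      on_line ((-2) ^ j) ((-1) ^ m *\<^sub>R p) \<longrightarrow> \<not> on_line ((-2) ^ Suc j) ((-1) ^ m *\<^sub>R p) \<longrightarrow>
      snd X (cell (2 ^ m) p) =
        Some ((opposite ^^ m) (crease_colour (crease_of (a (Suc j)) (aligned ((-2) ^ Suc j) ((-1) ^ m *\<^sub>R p))))))"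

lemma opposite_power: "(opposite ^^ m) c = (if even m then c else opposite c)"
proof (induction m)
  case (Suc m)
  then show ?case by (cases c) auto
qed simp

text \<open>Here \<open>b\<close> is the alignment, and
  \<open>b \<longleftrightarrow> even m\<close> tells whether the triangle is positive.
  \<open>F_+\<close> colours the interior of a positive triangle blue where a folding up of an
  upward layer creases red, hence the exponent \<open>Suc m\<close>.\<close>

lemma interior_colour_eq:
  "interior_colour \<epsilon> (b \<longleftrightarrow> even m) = (opposite ^^ Suc m) (crease_colour (crease_of \<epsilon> b))"
  unfolding opposite_power by (cases \<epsilon>; cases b; cases "even m") auto

lemma substitution_scaled_T0:
  assumes "fst X = scaled_T0 (2 ^ m)"
  shows "substitution \<epsilon> X = (scaled_T0 (2 ^ Suc m),
     \<lambda>e'. if e' \<notin> unit_edges (nodes (Suc m)) then None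
          else if \<exists>e\<in>unit_edges (nodes m). e' \<subseteq> (*\<^sub>R) 2 ` e
            then map_option opposite (snd X (THE e. e \<in> unit_edges (nodes m) \<and> e' \<subseteq> (*\<^sub>R) 2 ` e))
          else Some (interior_colour \<epsilon> (\<exists>\<tau>\<in>unit_triangles (nodes m). positive_triangle \<tau> \<and> e' \<subseteq> (*\<^sub>R) 2 ` \<tau>)))"
proof -
  have h: "homothety (center (scaled_T0 (2 ^ m))) 2 = (*\<^sub>R) 2"
    by (simp add: fun_eq_iff homothety_def center_scaled_T0)
  have D: "(*\<^sub>R) 2 ` scaled_T0 (2 ^ m) = scaled_T0 (2 ^ Suc m)"
    by (simp add: scaled_T0_image image_image)
  show ?thesis unfolding substitution_def Let_def assms h D subdivision_nodes_power ..
qed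

text \<open>The folding \<open>a 1\<close> is performed last and makes the finest creases, so
  prepending it shifts all others by one level. Old edges keep their crease up to the exchange of
  colours; new interior edges are those creased by \<open>a 1\<close>.\<close>

lemma folded_colouring_substitution:
  assumes X: "folded_colouring (\<lambda>i. a (Suc i)) m X"
  shows "folded_colouring a (Suc m) (substitution (a 1) X)"
proof -
  let ?Y = "substitution (a 1) X"
  have fX: "fst X = scaled_T0 (2 ^ m)" and dX: "dom (snd X) = unit_edges (nodes m)"
    using X by (simp_all add: folded_colouring_def)
  note Y = substitution_scaled_T0[OF fX, of "a 1"]
  have coarse: "snd ?Y e' = (if on_line 1 ((-1) ^ m *\<^sub>R (p /\<^sub>R 2))
      then map_option opposite (snd X (cell (2 ^ m) (p /\<^sub>R 2)))
      else Some (interior_colour (a 1) (\<exists>\<tau>\<in>unit_triangles (nodes m). positive_triangle \<tau> \<and> e' \<subseteq> (*\<^sub>R) 2 ` \<tau>)))"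
    if e': "e' \<in> unit_edges (nodes (Suc m))" "e' = closed_segment u v" and uv: "u \<in> nodes (Suc m)" "v \<in> nodes (Suc m)"
      "dist u v = 1" "p \<in> open_segment u v" for e' u v p
  proof -
    note ce = coarse_edge[OF uv, folded e'(2)]
    show ?thesis
    proof (cases "on_line 1 ((-1) ^ m *\<^sub>R (p /\<^sub>R 2))")
      case True
      have "(THE e. e \<in> unit_edges (nodes m) \<and> e' \<subseteq> (*\<^sub>R) 2 ` e) = cell (2 ^ m) (p /\<^sub>R 2)"
        by (rule the_equality) (use ce True in blast)+
      moreover have "\<exists>e\<in>unit_edges (nodes m). e' \<subseteq> (*\<^sub>R) 2 ` e" using ce True by blast
      ultimately show ?thesis unfolding Y using e'(1) True by simp
    next
      case False
      then have "\<not> (\<exists>e\<in>unit_edges (nodes m). e' \<subseteq> (*\<^sub>R) 2 ` e)" using ce by blast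
      then show ?thesis unfolding Y using e'(1) False by simp
    qed
  qed
  have "dom (snd ?Y) = unit_edges (nodes (Suc m))"
  proof (intro equalityI subsetI)
    fix e' assume "e' \<in> dom (snd ?Y)"
    then show "e' \<in> unit_edges (nodes (Suc m))" unfolding Y by (auto split: if_splits)
  next
    fix e' assume e': "e' \<in> unit_edges (nodes (Suc m))"
    then obtain u v p where uv: "e' = closed_segment u v" "u \<in> nodes (Suc m)" "v \<in> nodes (Suc m)"
      "dist u v = 1" "p \<in> open_segment u v" using unit_edges_nodesE by metis
    have "cell (2 ^ m) (p /\<^sub>R 2) \<in> dom (snd X)" if "on_line 1 ((-1) ^ m *\<^sub>R (p /\<^sub>R 2))"
      using coarse_edge(1)[OF uv(2-5) that] dX by simp
    then show "e' \<in> dom (snd ?Y)" using coarse[OF e' uv] by (auto simp: domIff)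
  qed
  moreover have "snd ?Y (cell (2 ^ Suc m) p) =
      Some ((opposite ^^ Suc m) (crease_colour (crease_of (a (Suc j)) (aligned ((-2) ^ Suc j) ((-1) ^ Suc m *\<^sub>R p)))))"
    if p: "p \<in> interior (scaled_T0 (2 ^ Suc m))" "p \<notin> lattice (2 ^ Suc m)"
     "on_line ((-2) ^ j) ((-1) ^ Suc m *\<^sub>R p)" "\<not> on_line ((-2) ^ Suc j) ((-1) ^ Suc m *\<^sub>R p)" for p j
  proof -
    let ?p = "p /\<^sub>R 2"
    define q where "q = (-1) ^ m *\<^sub>R ?p"
    \<comment> \<open>The doubling and the half-turn of one more substitution combine to the factor
      \<open>-2\<close>, under which level \<open>i\<close> becomes level
      \<open>Suc i\<close>.\<close>
    have q: "(-1) ^ Suc m *\<^sub>R p = (-2) *\<^sub>R q" by (simp add: q_def)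
    have on: "on_line ((-2) ^ Suc i) ((-2) *\<^sub>R q) \<longleftrightarrow> on_line ((-2) ^ i) q"
      and al: "aligned ((-2) ^ Suc i) ((-2) *\<^sub>R q) \<longleftrightarrow> aligned ((-2) ^ i) q" for i
      using on_line_scaleR[of "-2" "(-2) ^ i" q] aligned_scaleR[of "-2" "(-2) ^ i" q] by simp_all
    have "on_line 1 ((-1) ^ Suc m *\<^sub>R p)" using on_line_power_mono[OF p(3), of 0] by simp
    then obtain u v where uv: "cell (2 ^ Suc m) p = closed_segment u v" "u \<in> nodes (Suc m)" "v \<in> nodes (Suc m)"
      "dist u v = 1" "p \<in> open_segment u v" "cell (2 ^ Suc m) p \<in> unit_edges (nodes (Suc m))"
      using cell_unit_edge[OF _ p(2)] interior_subset p(1) by blast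
    note ce = coarse_edge[OF uv(2-5)]
    have Yc: "snd ?Y (cell (2 ^ Suc m) p) = (if on_line 1 q
      then map_option opposite (snd X (cell (2 ^ m) ?p))
      else Some (interior_colour (a 1) (\<exists>\<tau>\<in>unit_triangles (nodes m). positive_triangle \<tau> \<and> cell (2 ^ Suc m) p \<subseteq> (*\<^sub>R) 2 ` \<tau>)))"
      using coarse[OF uv(6,1-5)] unfolding q_def .
    show ?thesis
    proof (cases "on_line 1 q")
      case True
      \<comment> \<open>An old edge: its level is positive, and the invariant for the shifted
        sequence supplies its colour.\<close>
      then have "on_line ((-2) ^ Suc 0) ((-2) *\<^sub>R q)" unfolding on by simp
      then have "j \<noteq> 0" using p(4) unfolding q by (metis (no_types))
      then obtain i where j: "j = Suc i" by (cases j) auto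
      have "on_line ((-2) ^ i) q" "\<not> on_line ((-2) ^ Suc i) q" using p(3,4) unfolding q j on .
      moreover have "?p \<in> interior (scaled_T0 (2 ^ m))"
        using p(1) by (simp add: interior_scaled_T0 field_simps)
      ultimately have "snd X (cell (2 ^ m) ?p) = Some ((opposite ^^ m) (crease_colour
          (crease_of (a (Suc (Suc i))) (aligned ((-2) ^ Suc i) q))))"
        using X ce(5) unfolding folded_colouring_def q_def by blast
      then show ?thesis using True unfolding Yc q j al by simp
    next
      case False
      \<comment> \<open>A new edge: its level is 0, and its colour comes from the coarse unit
        triangle around the halved edge.\<close>
      have "j = 0"
      proof (rule ccontr)
        assume "j \<noteq> 0"
        then have "on_line ((-2) ^ Suc 0) ((-2) *\<^sub>R q)" using on_line_power_mono[OF p(3), of "Suc 0"] unfolding q by simp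
        then show False using False unfolding on by simp
      qed
      let ?A = "(\<lambda>x. x /\<^sub>R 2) ` cell (2 ^ Suc m) p"
      have sub: "cell (2 ^ Suc m) p \<subseteq> (*\<^sub>R) 2 ` T \<longleftrightarrow> ?A \<subseteq> T" for T :: "complex set"
        by (force simp: image_iff)
      have "p \<in> cell (2 ^ Suc m) p" by (simp add: cell_def)
      have "(\<exists>\<tau>\<in>unit_triangles (nodes m). positive_triangle \<tau> \<and> cell (2 ^ Suc m) p \<subseteq> (*\<^sub>R) 2 ` \<tau>)
          \<longleftrightarrow> upper (2 ^ m) 1 ?p + upper (2 ^ m) 2 ?p + upper (2 ^ m) 3 ?p = 3"
        unfolding sub nodes_def
      proof (rule positive_unit_triangle_iff)
        show "?A \<subseteq> cell (2 ^ m) ?p" using ce(2) unfolding uv(1)[symmetric] sub .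
        show "(coord i ?p - 2 ^ m) / 3 \<notin> \<int>" if "i \<in> {1,2,3}" for i
          using False that line_index_signed_Ints unfolding on_line_def q_def by blast
      qed (use ce(4) \<open>p \<in> cell (2 ^ Suc m) p\<close> in auto)
      also have "\<dots> \<longleftrightarrow> (aligned 1 q \<longleftrightarrow> even m)"
        using aligned_signed False unfolding q_def by blast
      finally show ?thesis using False interior_colour_eq[of "a 1" "aligned 1 q" m] unfolding Yc q \<open>j = 0\<close> al
        by (simp add: One_nat_def)
    qed
  qed
  ultimately show ?thesis unfolding folded_colouring_def using Y by simp
qed

section \<open>The substitution word\<close>

lemma substitution_word_Suc:
  "substitution_word a (Suc m) = substitution (a 1) \<circ> substitution_word (\<lambda>i. a (Suc i)) m"
proof -
  have "[1..<Suc (Suc m)] = 1 # map Suc [1..<Suc m]"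
    by (simp add: map_Suc_upt upt_conv_Cons One_nat_def del: upt_Suc)
  then show ?thesis by (simp only: substitution_word_def foldr.simps foldr_map comp_def)
qed

lemma substitution_word_add:
  "substitution_word a (k + m) = substitution_word a k \<circ> substitution_word (\<lambda>i. a (i + k)) m"
proof (induction k arbitrary: a)
  case 0
  have "substitution_word a 0 = id" by (simp add: substitution_word_def One_nat_def)
  then show ?case by simp
next
  case (Suc k)
  then show ?case by (simp add: substitution_word_Suc comp_assoc)
qed

lemma substitution_word_cong:
  assumes "\<And>i. i \<ge> 1 \<Longrightarrow> a i = b i"
  shows "substitution_word a m = substitution_word b m"
  unfolding substitution_word_def using assms by (intro foldr_cong) auto

text \<open>A shift by \<open>k\<close> leaves the sequence unchanged from index 1 on, so the
  \<open>n\<close> blocks of the longer word are all equal.\<close>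

lemma substitution_word_funpow:
  assumes "\<forall>i\<ge>1. a (i + k) = a i"
  shows "substitution_word a k ^^ n = substitution_word a (k * n)"
proof (induction n)
  case 0
  show ?case by (simp add: substitution_word_def One_nat_def)
next
  case (Suc n)
  have "substitution_word (\<lambda>i. a (i + k)) (k * n) = substitution_word a (k * n)"
    using assms by (intro substitution_word_cong) simp
  then show ?case using Suc substitution_word_add[of a k "k * n"] by simp
qed

text \<open>The induction varies the sequence, since removing the first letter of the word shifts
  the indices.\<close>

lemma folded_colouring_word:
  assumes "fst X = T0" "dom (snd X) = unit_edges (nodes 0)"
  shows "folded_colouring a m (substitution_word a m X)"
proof (induction m arbitrary: a)
  case 0
  \<comment> \<open>The interior of \<open>T0\<close> meets no grid line, so the condition on
    colours is vacuous at the start.\<close>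
  have "\<not> on_line ((-2) ^ j) p" if "p \<in> interior (scaled_T0 1)" for p j
    using interior_not_on_line[OF _ that] on_line_power_mono[of j p 0] by auto
  moreover have "scaled_T0 1 = T0" by (simp add: scaled_T0_image)
  ultimately show ?case using assms by (simp add: folded_colouring_def substitution_word_def One_nat_def)
next
  case (Suc m)
  then show ?case by (simp only: substitution_word_Suc comp_apply folded_colouring_substitution)
qed

section \<open>Comparison with the folding pattern\<close>

lemma lattice_cong:
  assumes "(s - t) / 3 \<in> \<int>"
  shows "lattice s = lattice t"
proof -
  have "(x - s) / 3 \<in> \<int> \<longleftrightarrow> (x - t) / 3 \<in> \<int>" for x
  proof -
    have "(x - t) / 3 = (x - s) / 3 + (s - t) / 3" by (simp flip: add_divide_distrib)
    then show ?thesis using assms by (metis Ints_add Ints_diff add_diff_cancel)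
  qed
  then show ?thesis by (simp add: lattice_def)
qed

text \<open>If no level were the last one, lying on a line would propagate from level 0 to all
  levels, including \<open>m\<close>.\<close>

lemma level_exists:
  assumes "on_line 1 p" "\<not> on_line ((-2) ^ m) p"
  shows "\<exists>j. on_line ((-2) ^ j) p \<and> \<not> on_line ((-2) ^ Suc j) p"
proof (rule ccontr)
  assume *: "\<not> ?thesis"
  have "on_line ((-2) ^ j) p" for j
    by (induction j) (use * assms(1) in auto)
  then show False using assms(2) by blast
qed

text \<open>The crease formula does not mention \<open>m\<close>, so all triangles around the edge
  give the same colour, and \<open>inside\<close> provides one of them; this settles the definite
  description.\<close>

lemma folding_pattern_edge:
  assumes uv: "u \<in> lattice 1" "v \<in> lattice 1" "dist u v = 1" "p \<in> open_segment u v"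
    and e: "closed_segment u v \<in> unit_edges grid_nodes"
    and inside: "edge_inside (closed_segment u v) (scaled_T0 ((-2) ^ m))"
    and j: "on_line ((-2) ^ j) p" "\<not> on_line ((-2) ^ Suc j) p"
  shows "folding_pattern a (closed_segment u v) =
    Some (crease_colour (crease_of (a (Suc j)) (aligned ((-2) ^ Suc j) p)))" (is "_ = Some ?c")
proof -
  have "finite_pattern a n (closed_segment u v) = Some ?c"
    if n: "edge_inside (closed_segment u v) (scaled_T0 ((-2) ^ n))" for n
  proof -
    have "u \<noteq> v" using uv(3) by auto
    then have "p \<in> interior (scaled_T0 ((-2) ^ n))"
      using n uv(4) by (auto simp: edge_inside_def rel_interior_closed_segment)
    then show ?thesis using crease_at_edge[OF uv _ j, of n a True] by (simp add: finite_pattern_def)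
  qed
  then have "(THE c. \<forall>m. edge_inside (closed_segment u v) (scaled_T0 ((-2) ^ m)) \<longrightarrow>
      finite_pattern a m (closed_segment u v) = Some c) = ?c"
    using inside by (intro the_equality) auto
  then show ?thesis using e by (simp add: folding_pattern_def)
qed

theorem theorem5p2:
  fixes a :: "nat \<Rightarrow> folding" and k n :: nat
  assumes "k > 0" and "even k"
    and "\<forall>i\<ge>1. a (i + k) = a i"
    and "n \<ge> 1"
  shows "edge_coloured_triangle ((substitution_word a k ^^ n) (seed (a 1)))
    \<and> fst ((substitution_word a k ^^ n) (seed (a 1))) = scaled_T0 (2 ^ (k * n))
    \<and> positive_triangle (scaled_T0 (2 ^ (k * n)))
    \<and> center (scaled_T0 (2 ^ (k * n))) = 0
    \<and> (\<forall>e. edge_inside e (scaled_T0 (2 ^ (k * n))) \<longrightarrow>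
           snd ((substitution_word a k ^^ n) (seed (a 1))) e = folding_pattern a e)"
proof -
  define m where "m = k * n"
  define X where "X = (substitution_word a k ^^ n) (seed (a 1))"
  let ?D = "scaled_T0 (2 ^ m)"
  have "even m" using assms(2) by (simp add: m_def)
  have "scaled_T0 1 = T0" by (simp add: scaled_T0_image)
  then have "dom (snd (seed (a 1))) = unit_edges (nodes 0)"
    using subdivision_nodes_power[of 0] by (auto simp: seed_def split: if_splits)
  then have "folded_colouring a m X"
    unfolding X_def substitution_word_funpow[OF assms(3)] m_def
    by (intro folded_colouring_word) (simp_all add: seed_def)
  \<comment> \<open>Evenness of \<open>m\<close> removes the half-turn and the exchange of colours
    from the invariant.\<close>
  then have X: "fst X = ?D" "dom (snd X) = unit_edges (nodes m)"
    and col: "\<And>p j. p \<in> interior ?D \<Longrightarrow> p \<notin> lattice (2 ^ m) \<Longrightarrow> on_line ((-2) ^ j) p \<Longrightarrow>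
      \<not> on_line ((-2) ^ Suc j) p \<Longrightarrow>
      snd X (cell (2 ^ m) p) = Some (crease_colour (crease_of (a (Suc j)) (aligned ((-2) ^ Suc j) p)))"
    using \<open>even m\<close> by (simp_all add: folded_colouring_def opposite_power)
  have pos: "positive_triangle ?D" by (rule positive_scaled_T0) simp
  have "regular_triangle (real (2 ^ m)) ?D"
    unfolding regular_triangle_def using regular_corners_scaled[of "2 ^ m"] scaled_T0_hull by auto
  then have ect: "edge_coloured_triangle X"
    unfolding edge_coloured_triangle_def X subdivision_nodes_power using pos by blast
  have D: "scaled_T0 ((-2) ^ m) = ?D" using \<open>even m\<close> by simp
  \<comment> \<open>For even \<open>m\<close> the offset \<open>2^m\<close> is
    \<open>(-2)^m\<close>, hence congruent to 1 modulo 3.\<close>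
  have lat: "lattice (2 ^ m) = lattice 1"
    using lattice_cong[OF Ints_power_minus_2[of m]] \<open>even m\<close> by simp
  have "snd X e = folding_pattern a e" if e: "edge_inside e ?D" for e
  proof (cases "e \<in> unit_edges grid_nodes")
    case True
    then obtain u v where uv: "e = closed_segment u v" "u \<in> lattice 1" "v \<in> lattice 1" "dist u v = 1"
      unfolding unit_edges_def regular_corners_def grid_nodes_eq_lattice by blast
    \<comment> \<open>The midpoint represents the edge: its cell is the edge, and its level tells
      which folding creases it.\<close>
    define p where "p = midpoint u v"
    have "u \<noteq> v" using uv(4) by auto
    then have p: "p \<in> open_segment u v" by (simp add: p_def)
    then have int: "p \<in> interior ?D"
      using e \<open>u \<noteq> v\<close> by (auto simp: edge_inside_def uv(1) rel_interior_closed_segment)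
    obtain i where i: "i \<in> {1,2,3}" "coord i u = coord i v" using edge_parallel_to_side[OF uv(2-4)] by blast
    have "coord i p = coord i u" using open_edge_coord_cases[OF uv(2-4) p i(1)] i(2) by auto
    then have "line_index 1 i p \<in> \<int>" using latticeD[OF uv(2) i(1)] by (simp add: line_index_def)
    then have "on_line 1 p" using i(1) unfolding on_line_def by blast
    moreover have "\<not> on_line ((-2) ^ m) p" using interior_not_on_line[of "(-2) ^ m" p] int D by simp
    ultimately obtain j where j: "on_line ((-2) ^ j) p" "\<not> on_line ((-2) ^ Suc j) p"
      using level_exists by blast
    have "p \<notin> lattice (2 ^ m)" using open_edge_not_lattice[OF uv(2-4) p] lat by simp
    moreover have "e = cell (2 ^ m) p"
      using closed_edge_eq_cell[of u "2 ^ m" v p] uv p lat by simp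
    ultimately show ?thesis
      using col[OF int _ j] folding_pattern_edge[OF uv(2-4) p _ _ j, of m a] True e D uv(1) by simp
  next
    case False
    \<comment> \<open>Nodes of the subdivided triangle are nodes of \<open>L\<close>, so off the
      edges of \<open>L\<close> both colourings are undefined.\<close>
    have "unit_edges (nodes m) \<subseteq> unit_edges grid_nodes"
      unfolding unit_edges_def grid_nodes_eq_lattice nodes_def lat by blast
    then have "snd X e = None" using False X(2) by blast
    then show ?thesis using False by (simp add: folding_pattern_def)
  qed
  then show ?thesis using ect X(1) pos center_scaled_T0[of "2 ^ m"] unfolding X_def m_def by simp
qed

end
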